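(* Fix a type $\Delta$ and let $\mathcal H$ be a finite non-empty set of pairwise incomparable $\Delta$-structures. (1) If $\mathrm{CSP}(H)$ is tractable for all $H\in\mathcal H$, then $\mathrm{GCSP}(\mathcal H)$ is tractable. (2) If $\mathrm{CSP}(H)$ is NP-complete for some $H\in\mathcal H$, then $\mathrm{GCSP}(\mathcal H)$ is NP-complete.
   Context: A type is a finite family $\Delta=(\delta_i:i\in I)$ of integers $\delta_i\ge 2$. A $\Delta$-structure $A$ consists of a finite non-empty base set $\underline{A}$ and relations $R_i(A)\subseteq\underline{A}^{\delta_i}$ ($i\in I$). A homomorphism $A\to B$ is a map of base sets mapping $R_i(A)$ into $R_i(B)$ for every $i$; write $A\to B$ if one exists. $A,B$ are incomparable if $A\not\to B$ and $B\not\to A$. For a fixed $\Delta$-structure $H$, $\mathrm{CSP}(H)$ is the problem to decide for an input $\Delta$-structure $G$ whether $G\to H$. For a fixed finite set $\mathcal H$ of $\Delta$-structures, $\mathrm{GCSP}(\mathcal H)$ is the problem to decide for an input $\Delta$-structure $G$ whether $G\to H$ for some $H\in\mathcal H$. A decision problem is tractable if it belongs to the class P. *)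

theory Defs
  imports "HOL-Library.Countable" "HOL-Computational_Algebra.Polynomial"
begin

section \<open>Relational structures and homomorphisms\<close>

text \<open>A type is a finite family \<open>(\<delta> i)\<close>, \<open>i \<in> I\<close>; values of \<open>\<delta>\<close> (and of
  \<open>rel A\<close> below) outside \<open>I\<close> are never looked at. Tuples are lists.\<close>

definition is_type :: "'i set \<Rightarrow> ('i \<Rightarrow> nat) \<Rightarrow> bool" where
  "is_type I \<delta> \<longleftrightarrow> finite I \<and> (\<forall>i\<in>I. 2 \<le> \<delta> i)"

record ('a, 'i) rstruct =
  base :: "'a set"
  rel :: "'i \<Rightarrow> 'a list set"

definition is_structure :: "'i set \<Rightarrow> ('i \<Rightarrow> nat) \<Rightarrow> ('a, 'i) rstruct \<Rightarrow> bool" where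
  "is_structure I \<delta> A \<longleftrightarrow>
     finite (base A) \<and> base A \<noteq> {} \<and>
     (\<forall>i\<in>I. \<forall>t\<in>rel A i. length t = \<delta> i \<and> set t \<subseteq> base A)"

definition is_hom :: "'i set \<Rightarrow> ('a, 'i) rstruct \<Rightarrow> ('b, 'i) rstruct \<Rightarrow> ('a \<Rightarrow> 'b) \<Rightarrow> bool" where
  "is_hom I A B h \<longleftrightarrow>
     h ` base A \<subseteq> base B \<and> (\<forall>i\<in>I. \<forall>t\<in>rel A i. map h t \<in> rel B i)"

definition hom_to :: "'i set \<Rightarrow> ('a, 'i) rstruct \<Rightarrow> ('b, 'i) rstruct \<Rightarrow> bool" where
  "hom_to I A B \<longleftrightarrow> (\<exists>h. is_hom I A B h)"

definition incomparable :: "'i set \<Rightarrow> ('a, 'i) rstruct \<Rightarrow> ('b, 'i) rstruct \<Rightarrow> bool" where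
  "incomparable I A B \<longleftrightarrow> \<not> hom_to I A B \<and> \<not> hom_to I B A"


section \<open>Multi-tape Turing machines\<close>

text \<open>States and tape symbols are natural numbers. The tape symbols are those below
  \<open>symbols M\<close>; \<open>0\<close> is the blank, and the input bits are \<open>1\<close> (False) and \<open>2\<close> (True).
  A tape is two-way infinite and is given by its contents and its head position.\<close>

datatype move = Move_Left | Stay | Move_Right

record tm =
  tapes :: nat
  symbols :: nat
  states :: "nat set"
  start :: nat
  accept :: nat
  reject :: nat
  trans :: "nat \<Rightarrow> nat list \<Rightarrow> nat \<times> (nat \<times> move) list"

type_synonym tape = "(int \<Rightarrow> nat) \<times> int"
type_synonym config = "nat \<times> tape list"

definition wf_tm :: "tm \<Rightarrow> bool" where
  "wf_tm M \<longleftrightarrow>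
     1 \<le> tapes M \<and> 3 \<le> symbols M \<and> finite (states M) \<and>
     start M \<in> states M \<and> accept M \<in> states M \<and> reject M \<in> states M \<and>
     accept M \<noteq> reject M \<and>
     (\<forall>q\<in>states M. \<forall>ss. length ss = tapes M \<and> set ss \<subseteq> {..<symbols M} \<longrightarrow>
        (case trans M q ss of (q', acts) \<Rightarrow>
           q' \<in> states M \<and> length acts = tapes M \<and> fst ` set acts \<subseteq> {..<symbols M}))"

fun shift :: "move \<Rightarrow> int \<Rightarrow> int" where
  "shift Move_Left p = p - 1"
| "shift Stay p = p"
| "shift Move_Right p = p + 1"

fun read_tape :: "tape \<Rightarrow> nat" where
  "read_tape (c, p) = c p"

fun act_tape :: "nat \<times> move \<Rightarrow> tape \<Rightarrow> tape" where
  "act_tape (s, d) (c, p) = (c(p := s), shift d p)"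

fun step :: "tm \<Rightarrow> config \<Rightarrow> config" where
  "step M (q, ts) =
     (if q = accept M \<or> q = reject M then (q, ts)
      else case trans M q (map read_tape ts) of (q', acts) \<Rightarrow> (q', map2 act_tape acts ts))"

fun bit_symbol :: "bool \<Rightarrow> nat" where
  "bit_symbol False = 1"
| "bit_symbol True = 2"

definition word_tape :: "bool list \<Rightarrow> tape" where
  "word_tape x =
     (\<lambda>j. if 0 \<le> j \<and> j < int (length x) then bit_symbol (x ! nat j) else 0, 0)"

text \<open>The input words are written on the first tapes, one word per tape.\<close>

definition init :: "tm \<Rightarrow> bool list list \<Rightarrow> config" where
  "init M xs = (start M, map word_tape xs @ replicate (tapes M - length xs) (word_tape []))"

definition accepts_within :: "tm \<Rightarrow> bool list list \<Rightarrow> nat \<Rightarrow> bool" where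
  "accepts_within M xs T \<longleftrightarrow> (\<exists>t\<le>T. fst ((step M ^^ t) (init M xs)) = accept M)"

definition rejects_within :: "tm \<Rightarrow> bool list list \<Rightarrow> nat \<Rightarrow> bool" where
  "rejects_within M xs T \<longleftrightarrow> (\<exists>t\<le>T. fst ((step M ^^ t) (init M xs)) = reject M)"

text \<open>A function value is left on the last tape, which is otherwise blank, with the head on
  the first cell of the value.\<close>

definition outputs_within :: "tm \<Rightarrow> bool list \<Rightarrow> bool list \<Rightarrow> nat \<Rightarrow> bool" where
  "outputs_within M x y T \<longleftrightarrow>
     (\<exists>t\<le>T. \<exists>ts. (step M ^^ t) (init M [x]) = (accept M, ts) \<and> last ts = word_tape y)"


section \<open>Complexity classes\<close>

type_synonym lang = "bool list set"

definition class_P :: "lang set" where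
  "class_P = {L. \<exists>M (p :: nat poly). wf_tm M \<and>
     (\<forall>x. (x \<in> L \<longrightarrow> accepts_within M [x] (poly p (length x))) \<and>
          (x \<notin> L \<longrightarrow> rejects_within M [x] (poly p (length x))))}"

text \<open>NP by deterministic polynomial-time verifiers, which find the instance \<open>x\<close> on their first
  tape and the certificate \<open>y\<close>, of length polynomial in that of \<open>x\<close>, on their second tape.\<close>

definition class_NP :: "lang set" where
  "class_NP = {L. \<exists>M (p :: nat poly) (r :: nat poly). wf_tm M \<and> 2 \<le> tapes M \<and>
     (\<forall>x y. length y \<le> poly r (length x) \<longrightarrow>
        accepts_within M [x, y] (poly p (length x)) \<or>
        rejects_within M [x, y] (poly p (length x))) \<and>
     (\<forall>x. x \<in> L \<longleftrightarrow>
        (\<exists>y. length y \<le> poly r (length x) \<and> accepts_within M [x, y] (poly p (length x))))}"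

definition poly_time_computable :: "(bool list \<Rightarrow> bool list) \<Rightarrow> bool" where
  "poly_time_computable f \<longleftrightarrow> (\<exists>M (p :: nat poly). wf_tm M \<and>
     (\<forall>x. outputs_within M x (f x) (poly p (length x))))"

definition poly_reducible :: "lang \<Rightarrow> lang \<Rightarrow> bool" where
  "poly_reducible L L' \<longleftrightarrow> (\<exists>f. poly_time_computable f \<and> (\<forall>x. x \<in> L \<longleftrightarrow> f x \<in> L'))"

abbreviation tractable :: "lang \<Rightarrow> bool" where
  "tractable L \<equiv> L \<in> class_P"

definition NP_complete :: "lang \<Rightarrow> bool" where
  "NP_complete L \<longleftrightarrow> L \<in> class_NP \<and> (\<forall>L'\<in>class_NP. poly_reducible L' L)"


section \<open>Constraint satisfaction problems as languages\<close>

text \<open>An input structure has base set \<open>{0, \<dots>, n - 1}\<close> and is written down as \<open>n\<close> followed by a list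
  of its tuples, each preceded by the index of its relation; order and repetitions do not matter.
  All numbers are in unary, so the code length is polynomially related to the
  number of elements plus the number of tuples, as for any usual encoding of structures of a fixed
  type. Words that are not codes count as no-instances.\<close>

definition unary :: "nat \<Rightarrow> bool list" where
  "unary n = replicate n True @ [False]"

fun encode_tuple :: "'i::countable \<times> nat list \<Rightarrow> bool list" where
  "encode_tuple (i, t) = unary (to_nat i) @ concat (map unary t)"

definition encode :: "nat \<Rightarrow> ('i::countable \<times> nat list) list \<Rightarrow> bool list" where
  "encode n ts = unary n @ concat (map encode_tuple ts)"

definition codes :: "'i::countable set \<Rightarrow> ('i \<Rightarrow> nat) \<Rightarrow> bool list \<Rightarrow> (nat, 'i) rstruct \<Rightarrow> bool" where
  "codes I \<delta> w G \<longleftrightarrow>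
     is_structure I \<delta> G \<and>
     (\<exists>n ts. w = encode n ts \<and> base G = {..<n} \<and> fst ` set ts \<subseteq> I \<and>
        (\<forall>i\<in>I. rel G i = {t. (i, t) \<in> set ts}))"

definition CSP :: "'i::countable set \<Rightarrow> ('i \<Rightarrow> nat) \<Rightarrow> ('a, 'i) rstruct \<Rightarrow> lang" where
  "CSP I \<delta> H = {w. \<exists>G. codes I \<delta> w G \<and> hom_to I G H}"

definition GCSP :: "'i::countable set \<Rightarrow> ('i \<Rightarrow> nat) \<Rightarrow> ('a, 'i) rstruct set \<Rightarrow> lang" where
  "GCSP I \<delta> \<H> = {w. \<exists>G. codes I \<delta> w G \<and> (\<exists>H\<in>\<H>. hom_to I G H)}"

text \<open>The encoding is unambiguous.\<close>

lemma unary_append_eq_iff: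
  "unary m @ u = unary n @ v \<longleftrightarrow> m = n \<and> u = v"
proof (induction m arbitrary: n)
  case 0
  show ?case by (cases n) (auto simp: unary_def)
next
  case (Suc m)
  show ?case using Suc[of "n - 1"] by (cases n) (auto simp: unary_def)
qed

lemma unary_list_append_eq:
  "length s = length t \<Longrightarrow> concat (map unary s) @ u = concat (map unary t) @ v \<Longrightarrow>
   s = t \<and> u = v"
  by (induction s t rule: list_induct2) (auto simp: unary_append_eq_iff)

lemma concat_encode_tuple_inj:
  fixes ts us :: "('i::countable \<times> nat list) list"
  assumes "\<forall>(i, t)\<in>set ts. length t = \<delta> i" "\<forall>(i, t)\<in>set us. length t = \<delta> i"
    and "concat (map encode_tuple ts) = concat (map encode_tuple us)"
  shows "ts = us"
  using assms
proof (induction ts arbitrary: us)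
  case Nil
  then show ?case by (cases us) (auto simp: unary_def)
next
  case (Cons x ts)
  obtain i t where x: "x = (i, t)" by (cases x)
  from Cons.prems x obtain j s us' where us: "us = (j, s) # us'"
    by (cases us) (auto simp: unary_def)
  have eq: "unary (to_nat i) @ concat (map unary t) @ concat (map encode_tuple ts) =
        unary (to_nat j) @ concat (map unary s) @ concat (map encode_tuple us')"
    using Cons.prems(3) x us by simp
  then have ij: "i = j" by (simp add: unary_append_eq_iff)
  with eq have "concat (map unary t) @ concat (map encode_tuple ts) =
        concat (map unary s) @ concat (map encode_tuple us')"
    by (simp add: unary_append_eq_iff)
  moreover have "length t = length s" using Cons.prems x us ij by simp
  ultimately have "t = s" "concat (map encode_tuple ts) = concat (map encode_tuple us')"
    using unary_list_append_eq by blast+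
  then show ?case using Cons.IH[of us'] Cons.prems x us ij by simp
qed

lemma codes_unique:
  assumes "codes I \<delta> w G" "codes I \<delta> w G'"
  shows "base G = base G' \<and> (\<forall>i\<in>I. rel G i = rel G' i)"
proof -
  have arity: "\<forall>(i, t)\<in>set ts. length t = \<delta> i"
    if "is_structure I \<delta> A" "fst ` set ts \<subseteq> I" "\<forall>i\<in>I. rel A i = {t. (i, t) \<in> set ts}"
    for A :: "(nat, 'a) rstruct" and ts
  proof (intro ballI, clarify)
    fix i t assume it: "(i, t) \<in> set ts"
    then have "fst (i, t) \<in> I" using that(2) by blast
    then have "i \<in> I" "t \<in> rel A i" using that(3) it by auto
    then show "length t = \<delta> i" using that(1) unfolding is_structure_def by blast
  qed
  obtain n ts where G: "w = encode n ts" "base G = {..<n}" "fst ` set ts \<subseteq> I"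
    "\<forall>i\<in>I. rel G i = {t. (i, t) \<in> set ts}"
    using assms(1) unfolding codes_def by blast
  obtain m us where G': "w = encode m us" "base G' = {..<m}" "fst ` set us \<subseteq> I"
    "\<forall>i\<in>I. rel G' i = {t. (i, t) \<in> set us}"
    using assms(2) unfolding codes_def by blast
  have eq: "n = m" "concat (map encode_tuple ts) = concat (map encode_tuple us)"
    using G(1) unfolding G'(1) encode_def unary_append_eq_iff by simp_all
  have "is_structure I \<delta> G" "is_structure I \<delta> G'"
    using assms unfolding codes_def by blast+
  then have "ts = us"
    using concat_encode_tuple_inj[OF arity[OF _ G(3,4)] arity[OF _ G'(3,4)] eq(2)] by blast
  then show ?thesis using eq(1) G(2,4) G'(2,4) by (metis (lifting))
qed

end

theory Submission imports Defs begin

text \<open>The first half holds for arbitrary languages: \<open>GCSP\<close> is the finite union of the languages \<open>CSP\<close>, and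
  the class P is closed under unions (\<open>class_P_Un\<close>).

  For the second half let \<open>H\<close> be a member of \<open>\<H>\<close> with an NP-complete problem. The map \<open>G \<mapsto> G + H\<close>
  (disjoint union) reduces \<open>CSP H\<close> to \<open>GCSP \<H>\<close>: a homomorphism from \<open>G + H\<close> to \<open>H'\<close> restricts to one
  from \<open>H\<close> to \<open>H'\<close>, so incomparability leaves only \<open>H' = H\<close>, and \<open>G + H \<rightarrow> H\<close> is equivalent to
  \<open>G \<rightarrow> H\<close>. On words this map can be computed by a finite transducer, because the copy of \<open>H\<close> may be
  put on the elements \<open>0, \<dots>, m - 1\<close>, where its code is a constant word, while shifting an
  element of \<open>G\<close> by \<open>m\<close> means to write \<open>m\<close> more letters in front of its unary block. Words that are not
  codes become words ending in True, which no code does (\<open>add_word_reduces\<close>). As NP-hardness is defined by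
  reductions from arbitrary languages, the transducer has to be composed with a given
  polynomial-time function (\<open>poly_time_transduce\<close>).

  Membership of \<open>GCSP \<H>\<close> in NP does not follow from that of a single \<open>CSP H\<close>, so it is proved by a verifier
  (\<open>GCSP_in_NP\<close>). A certificate is turned by another transducer into a tape that holds in cell \<open>x\<close> the image of
  the element \<open>x\<close>. Elements of tuples are in unary, so the head on that tape finds the image by moving one
  cell per letter; a single pass over the input suffices.

  Machines are put together from two programmed ones, the transducer and the verifier, by
  \<open>on_tapes\<close> (more tapes and symbols) and \<open>branch\<close> (sequential composition).\<close>

section \<open>Runs of machines\<close>

definition reach :: "tm \<Rightarrow> nat \<Rightarrow> config \<Rightarrow> config \<Rightarrow> bool" where
  "reach M T c c' \<longleftrightarrow> (\<exists>t\<le>T. (step M ^^ t) c = c')"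

lemma reach_refl: "reach M T c c"
  unfolding reach_def by (intro exI[of _ 0]) auto

lemma reach_trans:
  assumes "reach M T c c'" "reach M T' c' c''" "T + T' \<le> U"
  shows "reach M U c c''"
proof -
  obtain t t' where "t \<le> T" "(step M ^^ t) c = c'" "t' \<le> T'" "(step M ^^ t') c' = c''"
    using assms unfolding reach_def by blast
  then have "(step M ^^ (t' + t)) c = c''" "t' + t \<le> U"
    using assms(3) by (auto simp: funpow_add)
  then show ?thesis unfolding reach_def by blast
qed

lemma reach_step:
  assumes "step M c = c'" "reach M T c' c''" "Suc T \<le> U"
  shows "reach M U c c''"
proof -
  have "reach M 1 c c'" unfolding reach_def using assms(1) by (intro exI[of _ 1]) auto
  then show ?thesis using assms(2,3) reach_trans[of M 1 c c' T c'' U] by simp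
qed

definition exit_state :: "tm \<Rightarrow> bool \<Rightarrow> nat" where
  "exit_state M b = (if b then accept M else reject M)"

lemma funpow_step_exit: "(step M ^^ t) (exit_state M b, ts) = (exit_state M b, ts)"
  by (induction t) (auto simp: exit_state_def)

text \<open>A halted machine stays in its configuration, so the verdict of a run does not depend on
  when it is looked at.\<close>

lemma reach_exit_unique:
  assumes "reach M T c (exit_state M b, ts)" "reach M T' c (exit_state M b', ts')"
    and "accept M \<noteq> reject M"
  shows "b = b'"
proof -
  have later: "(step M ^^ s) c = (exit_state M d, us)"
    if "(step M ^^ t) c = (exit_state M d, us)" "t \<le> s" for s t d us
  proof -
    have "(step M ^^ (s - t + t)) c = (exit_state M d, us)"
      using that(1) by (simp only: funpow_add o_apply funpow_step_exit)
    then show ?thesis using that(2) by simp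
  qed
  obtain t t' where t: "(step M ^^ t) c = (exit_state M b, ts)"
    "(step M ^^ t') c = (exit_state M b', ts')"
    using assms(1,2) unfolding reach_def by blast
  have "(exit_state M b, ts) = (exit_state M b', ts')"
    using later[OF t(1), of "max t t'"] later[OF t(2), of "max t t'"] by simp
  then show ?thesis using assms(3) by (auto simp: exit_state_def split: if_splits)
qed

lemma exits_within_iff:
  "accepts_within M xs T \<longleftrightarrow> (\<exists>ts. reach M T (init M xs) (exit_state M True, ts))"
  "rejects_within M xs T \<longleftrightarrow> (\<exists>ts. reach M T (init M xs) (exit_state M False, ts))"
  unfolding accepts_within_def rejects_within_def reach_def exit_state_def
  by (auto simp: prod_eq_iff)

text \<open>The tape alphabet of a submachine is smaller than that of a machine built from it, so its
  transition function may be consulted only on configurations of the following kind.\<close>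

definition legal :: "tm \<Rightarrow> config \<Rightarrow> bool" where
  "legal M c \<longleftrightarrow> fst c \<in> states M \<and> length (snd c) = tapes M \<and>
     (\<forall>u\<in>set (snd c). \<forall>j. fst u j < symbols M)"

lemma act_tape_bound:
  assumes "\<forall>j. fst u j < m" "fst x < m"
  shows "fst (act_tape x u) j < m"
  using assms by (cases x; cases u) auto

lemma read_tape_bound: "\<forall>j. fst u j < m \<Longrightarrow> read_tape u < m"
  by (cases u) auto

lemma wf_tm_trans:
  assumes "wf_tm M" "q \<in> states M" "length ss = tapes M" "set ss \<subseteq> {..<symbols M}"
    and "trans M q ss = (q', acts)"
  shows "q' \<in> states M" "length acts = tapes M" "fst ` set acts \<subseteq> {..<symbols M}"
proof -
  have "case trans M q ss of (q', acts) \<Rightarrow>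
      q' \<in> states M \<and> length acts = tapes M \<and> fst ` set acts \<subseteq> {..<symbols M}"
    using assms(1-4) unfolding wf_tm_def by simp
  then show "q' \<in> states M" "length acts = tapes M" "fst ` set acts \<subseteq> {..<symbols M}"
    using assms(5) by simp_all
qed

lemma wf_tmI:
  assumes "1 \<le> tapes M" "3 \<le> symbols M" "finite (states M)" "start M \<in> states M"
    and "\<And>b. exit_state M b \<in> states M" "accept M \<noteq> reject M"
    and tr: "\<And>q ss q' acts. q \<in> states M \<Longrightarrow> length ss = tapes M \<Longrightarrow> set ss \<subseteq> {..<symbols M} \<Longrightarrow>
      trans M q ss = (q', acts) \<Longrightarrow>
      q' \<in> states M \<and> length acts = tapes M \<and> fst ` set acts \<subseteq> {..<symbols M}"
  shows "wf_tm M"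
proof -
  have *: "case trans M q ss of (q', acts) \<Rightarrow>
      q' \<in> states M \<and> length acts = tapes M \<and> fst ` set acts \<subseteq> {..<symbols M}"
    if "q \<in> states M" "length ss = tapes M \<and> set ss \<subseteq> {..<symbols M}" for q ss
    using tr[of q ss "fst (trans M q ss)" "snd (trans M q ss)"] that
    by (simp only: case_prod_beta prod.collapse)
  have ex: "accept M \<in> states M" "reject M \<in> states M"
    using assms(5)[of True] assms(5)[of False] by (simp_all add: exit_state_def)
  show ?thesis unfolding wf_tm_def
    by (intro conjI ballI allI impI) (rule * assms(1-4,6) ex; assumption)+
qed

lemma wf_tm_parts:
  assumes "wf_tm M"
  shows "1 \<le> tapes M" "3 \<le> symbols M" "finite (states M)" "start M \<in> states M"
    "exit_state M b \<in> states M" "accept M \<noteq> reject M"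
  using assms unfolding wf_tm_def exit_state_def by simp_all

lemma step_legal:
  assumes "wf_tm M" "legal M c"
  shows "legal M (step M c)"
proof -
  obtain q ts where c: "c = (q, ts)" by (cases c)
  obtain q' acts where tr: "trans M q (map read_tape ts) = (q', acts)" by fastforce
  have rd: "length (map read_tape ts) = tapes M" "set (map read_tape ts) \<subseteq> {..<symbols M}"
    using assms(2) read_tape_bound unfolding legal_def c by auto
  have "q \<in> states M" using assms(2) unfolding legal_def c by simp
  then have *: "q' \<in> states M \<and> length acts = tapes M \<and> fst ` set acts \<subseteq> {..<symbols M}"
    using wf_tm_trans[OF assms(1) _ rd tr] by blast
  have "fst u j < symbols M" if u: "u \<in> set (map2 act_tape acts ts)" for u j
  proof -
    obtain p where "p \<in> set (zip acts ts)" and up: "u = act_tape (fst p) (snd p)"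
      using u unfolding set_map by (metis (no_types, lifting) case_prod_beta imageE)
    then have "fst p \<in> set acts" "snd p \<in> set ts"
      by (metis prod.collapse set_zip_leftD set_zip_rightD)+
    then have "fst (fst p) < symbols M" "\<forall>j. fst (snd p) j < symbols M"
      using * assms(2) unfolding legal_def c by auto
    then show ?thesis unfolding up by (simp add: act_tape_bound)
  qed
  then show ?thesis using * assms(2) unfolding c legal_def by (auto simp: tr)
qed

lemma funpow_step_legal: "wf_tm M \<Longrightarrow> legal M c \<Longrightarrow> legal M ((step M ^^ t) c)"
  by (induction t) (auto simp: step_legal)

section \<open>Building machines from machines\<close>

abbreviation stay :: "nat \<Rightarrow> nat \<times> move" where
  "stay s \<equiv> (s, Stay)"

lemma act_stay: "map2 act_tape (map stay (map read_tape ts)) ts = ts"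
proof (induction ts)
  case (Cons u ts)
  then show ?case by (cases u) auto
qed simp

text \<open>The machine \<open>M\<close> works on the tapes from number \<open>a\<close> on. The transition function of \<open>M\<close> is
  unconstrained on symbols foreign to \<open>M\<close>, hence the guard: without it the result need not be well-formed.\<close>

definition on_tapes :: "nat \<Rightarrow> nat \<Rightarrow> nat \<Rightarrow> tm \<Rightarrow> tm" where
  "on_tapes a K m M = M\<lparr>tapes := K, symbols := m,
     trans := \<lambda>q ss. let mid = take (tapes M) (drop a ss) in
       if set mid \<subseteq> {..<symbols M} then
         case trans M q mid of (q', acts) \<Rightarrow>
           (q', map stay (take a ss) @ acts @ map stay (drop (a + tapes M) ss))
       else (q, map stay ss)\<rparr>"

lemma on_tapes_simps [simp]:
  "tapes (on_tapes a K m M) = K" "symbols (on_tapes a K m M) = m" "states (on_tapes a K m M) = states M"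
  "start (on_tapes a K m M) = start M" "accept (on_tapes a K m M) = accept M"
  "reject (on_tapes a K m M) = reject M" "exit_state (on_tapes a K m M) b = exit_state M b"
  by (simp_all add: on_tapes_def exit_state_def)

lemma wf_on_tapes:
  assumes "wf_tm M" "a + tapes M \<le> K" "symbols M \<le> m"
  shows "wf_tm (on_tapes a K m M)"
proof -
  have "q' \<in> states M \<and> length acts = K \<and> fst ` set acts \<subseteq> {..<m}"
    if q: "q \<in> states M" and ss: "length ss = K" "set ss \<subseteq> {..<m}"
      and tr: "trans (on_tapes a K m M) q ss = (q', acts)" for q ss q' acts
  proof -
    let ?mid = "take (tapes M) (drop a ss)"
    have len: "length ?mid = tapes M" using ss(1) assms(2) by simp
    show ?thesis
    proof (cases "set ?mid \<subseteq> {..<symbols M}")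
      case True
      obtain p as where p: "trans M q ?mid = (p, as)" by fastforce
      have "q' = p" and acts: "acts = map stay (take a ss) @ as @ map stay (drop (a + tapes M) ss)"
        using tr p True by (simp_all add: on_tapes_def Let_def)
      moreover have "fst ` set as \<subseteq> {..<m}"
        using wf_tm_trans(3)[OF assms(1) q len True p] assms(3) by fastforce
      moreover have "set (take a ss) \<subseteq> {..<m}" "set (drop (a + tapes M) ss) \<subseteq> {..<m}"
        using ss(2) set_take_subset set_drop_subset by (meson order_trans)+
      ultimately show ?thesis
        using wf_tm_trans(1,2)[OF assms(1) q len True p] ss(1) assms(2)
        unfolding acts by (simp add: image_Un image_image)
    next
      case False
      then have "q' = q" "acts = map stay ss" using tr by (simp_all add: on_tapes_def Let_def)
      then show ?thesis using q ss by (simp add: image_image)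
    qed
  qed
  moreover note wf_tm_parts[OF assms(1)]
  ultimately show ?thesis using assms(2,3)
    by (intro wf_tmI) simp_all
qed

lemma step_on_tapes:
  assumes "legal M (q, ts)" "length pre = a"
    and "step M (q, ts) = (q', ts')"
    and "wf_tm M"
  shows "step (on_tapes a K m M) (q, pre @ ts @ post) = (q', pre @ ts' @ post)"
proof -
  have len: "length ts = tapes M" using assms(1) unfolding legal_def by simp
  have rd: "set (map read_tape ts) \<subseteq> {..<symbols M}"
    using assms(1) read_tape_bound unfolding legal_def by auto
  obtain p acts where tr: "trans M q (map read_tape ts) = (p, acts)" by fastforce
  have q: "q \<in> states M" using assms(1) unfolding legal_def by simp
  have "length acts = tapes M"
    using wf_tm_trans(2)[OF assms(4) q _ rd tr] len by simp
  then show ?thesis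
    using assms(2,3) len rd tr act_stay[of pre] act_stay[of post]
    by (auto simp: on_tapes_def Let_def)
qed

lemma reach_on_tapes:
  assumes "wf_tm M" "legal M (q, ts)" "length pre = a"
    and "reach M T (q, ts) (q', ts')"
  shows "reach (on_tapes a K m M) T (q, pre @ ts @ post) (q', pre @ ts' @ post)"
proof -
  have "\<And>q' ts'. (step M ^^ t) (q, ts) = (q', ts') \<Longrightarrow>
     (step (on_tapes a K m M) ^^ t) (q, pre @ ts @ post) = (q', pre @ ts' @ post)" for t
  proof (induction t)
    case (Suc t)
    obtain p us where p: "(step M ^^ t) (q, ts) = (p, us)" by fastforce
    then have "legal M (p, us)" using funpow_step_legal[OF assms(1,2), of t] by simp
    then show ?case using Suc.prems Suc.IH[OF p] p step_on_tapes[OF _ assms(3) _ assms(1)] by simp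
  qed simp
  then show ?thesis using assms(4) unfolding reach_def by blast
qed

text \<open>\<open>branch True M N\<close> is the sequential composition of \<open>M\<close> and \<open>N\<close>, and \<open>branch False M N\<close> tries
  \<open>N\<close> if \<open>M\<close> rejects. The states of the two machines are kept apart by their parity.\<close>

definition branch :: "bool \<Rightarrow> tm \<Rightarrow> tm \<Rightarrow> tm" where
  "branch b M N = \<lparr>tapes = tapes M, symbols = symbols M,
     states = (\<lambda>q. 2 * q) ` states M \<union> (\<lambda>q. 2 * q + 1) ` states N,
     start = 2 * start M, accept = 2 * accept N + 1, reject = 2 * reject N + 1,
     trans = \<lambda>s ss.
       if even s then
         if s div 2 = exit_state M b then (2 * start N + 1, map stay ss)
         else if s div 2 = exit_state M (\<not> b) then (2 * exit_state N (\<not> b) + 1, map stay ss)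
         else case trans M (s div 2) ss of (q', acts) \<Rightarrow> (2 * q', acts)
       else case trans N (s div 2) ss of (q', acts) \<Rightarrow> (2 * q' + 1, acts)\<rparr>"

lemma branch_simps [simp]:
  "tapes (branch b M N) = tapes M" "symbols (branch b M N) = symbols M"
  "start (branch b M N) = 2 * start M" "exit_state (branch b M N) d = 2 * exit_state N d + 1"
  by (simp_all add: branch_def exit_state_def)

lemma wf_branch:
  assumes "wf_tm M" "wf_tm N" "tapes M = tapes N" "symbols M = symbols N"
  shows "wf_tm (branch b M N)"
proof -
  let ?B = "branch b M N"
  have ex: "start N \<in> states N" "exit_state N d \<in> states N" for d
    using assms(2) unfolding wf_tm_def exit_state_def by auto
  have "q' \<in> states ?B \<and> length acts = tapes M \<and> fst ` set acts \<subseteq> {..<symbols M}"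
    if s: "s \<in> states ?B" and ss: "length ss = tapes M" "set ss \<subseteq> {..<symbols M}"
      and tr: "trans ?B s ss = (q', acts)" for s ss q' acts
  proof (cases "even s")
    case True
    then obtain q where q: "s = 2 * q" "q \<in> states M"
      using s by (auto simp: branch_def)
    show ?thesis
    proof (cases "q = exit_state M b \<or> q = exit_state M (\<not> b)")
      case True
      then have "(\<exists>p\<in>states N. q' = 2 * p + 1) \<and> acts = map stay ss"
        using tr q(1) ex by (auto simp: branch_def split: if_splits)
      then show ?thesis using ss by (auto simp: branch_def image_image)
    next
      case False
      obtain p as where p: "trans M q ss = (p, as)" by fastforce
      then have "q' = 2 * p" "acts = as" using tr q(1) False by (auto simp: branch_def)
      then show ?thesis using wf_tm_trans[OF assms(1) q(2) ss p] by (simp add: branch_def)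
    qed
  next
    case False
    then obtain q where q: "s = 2 * q + 1" "q \<in> states N"
      using s by (auto simp: branch_def)
    obtain p as where p: "trans N q ss = (p, as)" by fastforce
    then have "q' = 2 * p + 1" "acts = as" using tr q(1) by (auto simp: branch_def)
    then show ?thesis using wf_tm_trans[OF assms(2) q(2) _ _ p] ss assms(3,4)
      by (simp add: branch_def)
  qed
  moreover have "states ?B = (\<lambda>q. 2 * q) ` states M \<union> (\<lambda>q. 2 * q + 1) ` states N"
    "accept ?B \<noteq> reject ?B"
    using wf_tm_parts(6)[OF assms(2)] by (simp_all add: branch_def)
  then have "finite (states ?B)" "start ?B \<in> states ?B" "\<And>d. exit_state ?B d \<in> states ?B"
    "accept ?B \<noteq> reject ?B"
    using wf_tm_parts(3,4)[OF assms(1)] wf_tm_parts(3)[OF assms(2)] ex by simp_all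
  ultimately show ?thesis using wf_tm_parts(1,2)[OF assms(1)] by (intro wf_tmI) simp_all
qed

lemma reach_branch_first:
  assumes "reach M T (q, ts) (exit_state M d, ts')"
  shows "reach (branch b M N) T (2 * q, ts) (2 * exit_state M d, ts')"
proof -
  have "\<exists>t'\<le>t. (step (branch b M N) ^^ t') (2 * q, ts) = (2 * exit_state M d, ts')"
    if "(step M ^^ t) (q, ts) = (exit_state M d, ts')" for t
    using that
  proof (induction t arbitrary: q ts)
    case 0
    then show ?case by auto
  next
    case (Suc t)
    show ?case
    proof (cases "q = accept M \<or> q = reject M")
      case True
      then obtain e where e: "q = exit_state M e" by (metis exit_state_def)
      then have "(q, ts) = (exit_state M d, ts')" using Suc.prems funpow_step_exit by metis
      then show ?thesis by (intro exI[of _ 0]) auto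
    next
      case False
      obtain p us where p: "step M (q, ts) = (p, us)" by fastforce
      then have "(step M ^^ t) (p, us) = (exit_state M d, ts')"
        using Suc.prems by (simp add: funpow_swap1)
      then obtain t' where t': "t' \<le> t"
        "(step (branch b M N) ^^ t') (2 * p, us) = (2 * exit_state M d, ts')"
        using Suc.IH by blast
      have "2 * q \<noteq> Suc (2 * k)" for k by presburger
      then have "step (branch b M N) (2 * q, ts) = (2 * p, us)"
        using False p by (auto simp: branch_def exit_state_def split: prod.splits)
      then have "(step (branch b M N) ^^ Suc t') (2 * q, ts) = (2 * exit_state M d, ts')"
        using t'(2) by (simp add: funpow_swap1)
      then show ?thesis using t'(1) by (meson Suc_le_mono)
    qed
  qed
  then show ?thesis using assms unfolding reach_def by (meson order_trans)
qed

lemma reach_branch_second: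
  assumes "reach N T (q, ts) (q', ts')"
  shows "reach (branch b M N) T (2 * q + 1, ts) (2 * q' + 1, ts')"
proof -
  have "(step (branch b M N) ^^ t) (2 * q + 1, ts) =
      (case (step N ^^ t) (q, ts) of (q', ts') \<Rightarrow> (2 * q' + 1, ts'))" for t
    by (induction t) (auto simp: branch_def split: prod.splits)
  then show ?thesis using assms unfolding reach_def by (metis case_prod_conv)
qed

lemma step_branch_exit:
  "step (branch b M N) (2 * exit_state M b, ts) = (2 * start N + 1, ts)"
  "accept M \<noteq> reject M \<Longrightarrow>
   step (branch b M N) (2 * exit_state M (\<not> b), ts) = (2 * exit_state N (\<not> b) + 1, ts)"
proof -
  have "2 * q \<noteq> Suc (2 * k)" for q k :: nat by presburger
  then show "step (branch b M N) (2 * exit_state M b, ts) = (2 * start N + 1, ts)"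
    "accept M \<noteq> reject M \<Longrightarrow>
     step (branch b M N) (2 * exit_state M (\<not> b), ts) = (2 * exit_state N (\<not> b) + 1, ts)"
    using act_stay[of ts] by (auto simp: branch_def exit_state_def)
qed

lemma reach_branch_continue:
  assumes "reach M T (start M, ts) (exit_state M b, us)"
    and "reach N U (start N, us) (q, vs)" "T + U + 1 \<le> V"
  shows "reach (branch b M N) V (start (branch b M N), ts) (2 * q + 1, vs)"
proof -
  have "reach (branch b M N) T (start (branch b M N), ts) (2 * exit_state M b, us)"
    using reach_branch_first[OF assms(1)] by simp
  moreover have "reach (branch b M N) (Suc U) (2 * exit_state M b, us) (2 * q + 1, vs)"
    using reach_step[OF step_branch_exit(1) reach_branch_second[OF assms(2)]] by simp
  ultimately show ?thesis by (rule reach_trans) (use assms(3) in simp)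
qed

lemma reach_branch_stop:
  assumes "reach M T (start M, ts) (exit_state M (\<not> b), us)" "accept M \<noteq> reject M"
    and "T + 1 \<le> V"
  shows "reach (branch b M N) V (start (branch b M N), ts) (exit_state (branch b M N) (\<not> b), us)"
proof -
  have "reach (branch b M N) T (start (branch b M N), ts) (2 * exit_state M (\<not> b), us)"
    using reach_branch_first[OF assms(1)] by simp
  moreover have "reach (branch b M N) 1 (2 * exit_state M (\<not> b), us)
      (exit_state (branch b M N) (\<not> b), us)"
    using reach_step[OF step_branch_exit(2)[OF assms(2)] reach_refl, of 0] by simp
  ultimately show ?thesis by (rule reach_trans) (use assms(3) in simp)
qed

text \<open>The machines programmed by hand look only at their first and last tape; their states may be
  taken from any countable type.\<close>

definition two_head :: "nat \<Rightarrow> nat \<Rightarrow> 's::countable set \<Rightarrow> 's \<Rightarrow> 's \<Rightarrow> 's \<Rightarrow>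
    ('s \<Rightarrow> nat \<Rightarrow> nat \<Rightarrow> 's \<times> (nat \<times> move) \<times> (nat \<times> move)) \<Rightarrow> tm" where
  "two_head K m S s0 sa sr f = \<lparr>tapes = K, symbols = m, states = to_nat ` S,
     start = to_nat s0, accept = to_nat sa, reject = to_nat sr,
     trans = \<lambda>q ss. case f (from_nat q) (hd ss) (last ss) of
       (s', x, y) \<Rightarrow> (to_nat s', x # map stay (butlast (tl ss)) @ [y])\<rparr>"

lemma two_head_simps [simp]:
  "tapes (two_head K m S s0 sa sr f) = K" "symbols (two_head K m S s0 sa sr f) = m"
  "start (two_head K m S s0 sa sr f) = to_nat s0"
  "states (two_head K m S s0 sa sr f) = to_nat ` S"
  "exit_state (two_head K m S s0 sa sr f) b = to_nat (if b then sa else sr)"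
  by (simp_all add: two_head_def exit_state_def)

lemma wf_two_head:
  assumes "2 \<le> K" "3 \<le> m" "finite S" "s0 \<in> S" "sa \<in> S" "sr \<in> S" "sa \<noteq> sr"
    and f: "\<And>s a b s' x y. s \<in> S \<Longrightarrow> a < m \<Longrightarrow> b < m \<Longrightarrow> f s a b = (s', x, y) \<Longrightarrow>
      s' \<in> S \<and> fst x < m \<and> fst y < m"
  shows "wf_tm (two_head K m S s0 sa sr f)"
proof -
  have "q' \<in> to_nat ` S \<and> length acts = K \<and> fst ` set acts \<subseteq> {..<m}"
    if q: "q \<in> to_nat ` S" and ss: "length ss = K" "set ss \<subseteq> {..<m}"
      and tr: "trans (two_head K m S s0 sa sr f) q ss = (q', acts)" for q ss q' acts
  proof -
    obtain s where s: "q = to_nat s" "s \<in> S" using q by blast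
    obtain s' x y where f': "f s (hd ss) (last ss) = (s', x, y)" by (metis prod_cases3)
    have ne: "ss \<noteq> []" using ss assms(1) by auto
    then have "hd ss < m" "last ss < m" using ss(2) hd_in_set last_in_set by blast+
    then have *: "s' \<in> S \<and> fst x < m \<and> fst y < m" using f s(2) f' by blast
    have q': "q' = to_nat s'" "acts = x # map stay (butlast (tl ss)) @ [y]"
      using tr s(1) f' by (simp_all add: two_head_def)
    have "set (butlast (tl ss)) \<subseteq> {..<m}"
      using ss(2) ne by (meson in_set_butlastD list.set_sel(2) subset_iff)
    moreover have "length (butlast (tl ss)) + 2 = K" using ss(1) assms(1) by simp
    ultimately show ?thesis using * unfolding q' by (auto simp: image_image)
  qed
  then show ?thesis using assms(1-7)
    by (intro wf_tmI) (auto simp: two_head_def exit_state_def)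
qed

lemma step_two_head:
  assumes "s \<noteq> sa" "s \<noteq> sr" "f s (read_tape a) (read_tape b) = (s', x, y)"
  shows "step (two_head K m S s0 sa sr f) (to_nat s, a # mid @ [b]) =
    (to_nat s', act_tape x a # mid @ [act_tape y b])"
  using assms act_stay[of mid] by (simp add: two_head_def butlast_append)

declare step.simps [simp del]

lemma reach_one: "step M c = c' \<Longrightarrow> 1 \<le> U \<Longrightarrow> reach M U c c'"
  using reach_step[OF _ reach_refl, of M c c' 0 U] by simp

section \<open>Finite transducers\<close>

definition cells :: "nat list \<Rightarrow> int \<Rightarrow> nat" where
  "cells xs j = (if 0 \<le> j \<and> j < int (length xs) then xs ! nat j else 0)"

lemma word_tape_cells: "word_tape x = (cells (map bit_symbol x), 0)"
  unfolding word_tape_def cells_def by (auto simp: fun_eq_iff)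

lemma cells_append_nth [simp]: "cells (xs @ a # ys) (int (length xs)) = a"
  by (simp add: cells_def)

lemma cells_end [simp]: "cells xs (int (length xs)) = 0" "cells xs (-1) = 0"
  by (simp_all add: cells_def)

lemma cells_write [simp]: "(cells xs)(int (length xs) := s) = cells (xs @ [s])"
  by (auto simp: fun_eq_iff cells_def nth_append)

lemma cells_nonzero: "0 \<notin> set xs \<Longrightarrow> 0 \<le> j \<Longrightarrow> j < int (length xs) \<Longrightarrow> cells xs j \<noteq> 0"
  by (metis cells_def nth_mem nat_less_iff)

lemma cells_bound: "set xs \<subseteq> {..<m} \<Longrightarrow> 0 < m \<Longrightarrow> cells xs j < m"
  unfolding cells_def by (auto simp: nat_less_iff subset_iff)

lemma bit_symbol_range: "1 \<le> bit_symbol b" "bit_symbol b \<le> 2" "bit_symbol b \<noteq> 0"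
  by (cases b; simp)+

lemma bit_symbol_eq [simp]: "bit_symbol b = 2 \<longleftrightarrow> b" "bit_symbol b = Suc 0 \<longleftrightarrow> \<not> b"
  by (cases b; simp)+

text \<open>The output \<open>fin q\<close> at the end of the word allows a transducer to react to a word that
  breaks off too early.\<close>

primrec transduce :: "('q \<Rightarrow> bool \<Rightarrow> 'q \<times> 'o list) \<Rightarrow> ('q \<Rightarrow> 'o list) \<Rightarrow> 'q \<Rightarrow> bool list \<Rightarrow> 'o list" where
  "transduce \<tau> fin q [] = fin q"
| "transduce \<tau> fin q (b # w) = snd (\<tau> q b) @ transduce \<tau> fin (fst (\<tau> q b)) w"

text \<open>The bound \<open>B\<close> makes the states of the machine finite in number, as they contain pending output. The
  blank \<open>0\<close> is not an output, so that the ends of the output can be found when rewinding.\<close>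

definition is_transducer :: "'q set \<Rightarrow> ('q \<Rightarrow> bool \<Rightarrow> 'q \<times> nat list) \<Rightarrow> ('q \<Rightarrow> nat list) \<Rightarrow> nat \<Rightarrow> nat \<Rightarrow> bool"
  where "is_transducer Q \<tau> fin m B \<longleftrightarrow> finite Q \<and>
    (\<forall>q\<in>Q. (\<forall>b. fst (\<tau> q b) \<in> Q \<and> set (snd (\<tau> q b)) \<subseteq> {1..<m} \<and> length (snd (\<tau> q b)) \<le> B) \<and>
      set (fin q) \<subseteq> {1..<m} \<and> length (fin q) \<le> B)"

lemma transduce_bounds:
  assumes "is_transducer Q \<tau> fin m B" "q \<in> Q"
  shows "set (transduce \<tau> fin q w) \<subseteq> {1..<m} \<and> length (transduce \<tau> fin q w) \<le> B * (length w + 1)"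
  using assms(2)
proof (induction w arbitrary: q)
  case Nil
  then show ?case using assms(1) by (simp add: is_transducer_def)
next
  case (Cons b w)
  then have "fst (\<tau> q b) \<in> Q" "set (snd (\<tau> q b)) \<subseteq> {1..<m}" "length (snd (\<tau> q b)) \<le> B"
    using assms(1) by (simp_all add: is_transducer_def)
  then show ?case using Cons.IH[of "fst (\<tau> q b)"] by simp
qed

datatype 'q tstate = Scan 'q | Emit "'q option" "nat list" | Rewind | Done | Fail

instance tstate :: (countable) countable by countable_datatype

text \<open>The state \<open>Emit oq u\<close> has still to write \<open>u\<close>; afterwards the machine scans on from the state in
  \<open>oq\<close>, or rewinds both tapes if there is none.\<close>

fun tstep :: "('q \<Rightarrow> bool \<Rightarrow> 'q \<times> nat list) \<Rightarrow> ('q \<Rightarrow> nat list) \<Rightarrow> 'q tstate \<Rightarrow> nat \<Rightarrow> nat \<Rightarrow>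
    'q tstate \<times> (nat \<times> move) \<times> (nat \<times> move)" where
  "tstep \<tau> fin (Scan q) a b =
    (if a = 0 then (Emit None (fin q), (a, Move_Left), stay b)
     else (Emit (Some (fst (\<tau> q (a = 2)))) (snd (\<tau> q (a = 2))), (a, Move_Right), stay b))"
| "tstep \<tau> fin (Emit oq (s # u)) a b = (Emit oq u, stay a, (s, Move_Right))"
| "tstep \<tau> fin (Emit (Some q) []) a b = (Scan q, stay a, stay b)"
| "tstep \<tau> fin (Emit None []) a b = (Rewind, stay a, (b, Move_Left))"
| "tstep \<tau> fin Rewind a b =
    (if a = 0 \<and> b = 0 then (Done, (a, Move_Right), (b, Move_Right))
     else (Rewind, (a, if a = 0 then Stay else Move_Left), (b, if b = 0 then Stay else Move_Left)))"
| "tstep \<tau> fin s a b = (s, stay a, stay b)"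

definition tstates :: "'q set \<Rightarrow> nat \<Rightarrow> nat \<Rightarrow> 'q tstate set" where
  "tstates Q m B = Scan ` Q \<union>
     (\<lambda>(oq, u). Emit oq u) ` (insert None (Some ` Q) \<times> {u. set u \<subseteq> {1..<m} \<and> length u \<le> B}) \<union>
     {Rewind, Done, Fail}"

definition transducer :: "nat \<Rightarrow> nat \<Rightarrow> 'q::countable set \<Rightarrow> ('q \<Rightarrow> bool \<Rightarrow> 'q \<times> nat list) \<Rightarrow>
    ('q \<Rightarrow> nat list) \<Rightarrow> nat \<Rightarrow> 'q \<Rightarrow> tm" where
  "transducer K m Q \<tau> fin B q0 = two_head K m (tstates Q m B) (Scan q0) Done Fail (tstep \<tau> fin)"

lemma transducer_simps [simp]:
  "tapes (transducer K m Q \<tau> fin B q0) = K" "symbols (transducer K m Q \<tau> fin B q0) = m"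
  by (simp_all add: transducer_def)

lemma wf_transducer:
  assumes "is_transducer Q \<tau> fin m B" "q0 \<in> Q" "2 \<le> K" "3 \<le> m"
  shows "wf_tm (transducer K m Q \<tau> fin B q0)"
  unfolding transducer_def
proof (rule wf_two_head)
  have "finite Q" using assms(1) by (simp add: is_transducer_def)
  moreover have "finite {u. set u \<subseteq> {1..<m} \<and> length u \<le> B}" by (rule finite_lists_length_le) simp
  ultimately show "finite (tstates Q m B)" unfolding tstates_def by simp
  show "Scan q0 \<in> tstates Q m B" "Done \<in> tstates Q m B" "Fail \<in> tstates Q m B"
    using assms(2) by (auto simp: tstates_def)
  fix s a b s' x y
  assume s: "s \<in> tstates Q m B" and ab: "a < m" "b < m" and f: "tstep \<tau> fin s a b = (s', x, y)"
  have emit: "Emit oq u \<in> tstates Q m B \<longleftrightarrow>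
      oq \<in> insert None (Some ` Q) \<and> set u \<subseteq> {1..<m} \<and> length u \<le> B" for oq u
    by (auto simp: tstates_def)
  have scan: "Scan q \<in> tstates Q m B \<longleftrightarrow> q \<in> Q" "Rewind \<in> tstates Q m B" "Done \<in> tstates Q m B" for q
    by (auto simp: tstates_def)
  show "s' \<in> tstates Q m B \<and> fst x < m \<and> fst y < m"
  proof (cases "(\<tau>, fin, s, a, b)" rule: tstep.cases)
    case (1 \<tau>' fin' q a' b')
    then have "q \<in> Q" using s scan by simp
    then show ?thesis using 1 assms(1) ab f emit
      by (auto simp: is_transducer_def split: if_splits)
  next
    case (2 \<tau>' fin' oq z u a' b')
    then show ?thesis using s ab f emit[of oq "z # u"] emit[of oq u] by auto
  next
    case (3 \<tau>' fin' q a' b')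
    then show ?thesis using s ab f emit scan by auto
  next
    case (5 \<tau>' fin' a' b')
    then show ?thesis using s ab f scan by (auto split: if_splits)
  qed (use s ab f scan in auto)
qed (use assms in auto)

context
  fixes K m B :: nat and Q :: "'q::countable set" and \<tau> :: "'q \<Rightarrow> bool \<Rightarrow> 'q \<times> nat list"
    and fin :: "'q \<Rightarrow> nat list" and q0 :: 'q and T :: tm
  defines "T \<equiv> transducer K m Q \<tau> fin B q0"
begin

lemma transducer_step:
  assumes "s \<noteq> Done" "s \<noteq> Fail"
  shows "step T (to_nat s, (c, p) # mid @ [(d, r)]) =
    (case tstep \<tau> fin s (c p) (d r) of (s', (z, e), (z', e')) \<Rightarrow>
      (to_nat s', (c(p := z), shift e p) # mid @ [(d(r := z'), shift e' r)]))"
  unfolding T_def transducer_def using assms step_two_head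
  by (auto split: prod.splits)

lemma transducer_emit:
  "reach T (length u) (to_nat (Emit oq u :: 'q tstate), a # mid @ [(cells ys, int (length ys))])
     (to_nat (Emit oq [] :: 'q tstate), a # mid @ [(cells (ys @ u), int (length (ys @ u)))])"
proof (induction u arbitrary: ys)
  case Nil
  show ?case by (simp add: reach_refl)
next
  case (Cons s u)
  obtain c p where a: "a = (c, p)" by (cases a)
  have "step T (to_nat (Emit oq (s # u) :: 'q tstate), a # mid @ [(cells ys, int (length ys))]) =
    (to_nat (Emit oq u :: 'q tstate), a # mid @ [(cells (ys @ [s]), int (length (ys @ [s])))])"
    by (simp add: a transducer_step add.commute)
  from reach_step[OF this Cons.IH[of "ys @ [s]"], of "length (s # u)"] show ?case by simp
qed

text \<open>The invariant splits the input into the part \<open>v\<close> that has been read and the rest \<open>w\<close>; \<open>ys\<close> is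
  the output so far.\<close>

lemma transducer_scan:
  assumes "is_transducer Q \<tau> fin m B" "q \<in> Q"
  shows "reach T ((B + 2) * (length w + 1))
     (to_nat (Scan q), (cells (map bit_symbol (v @ w)), int (length v)) # mid @ [(cells ys, int (length ys))])
     (to_nat (Rewind :: 'q tstate), (cells (map bit_symbol (v @ w)), int (length (v @ w)) - 1) #
        mid @ [(cells (ys @ transduce \<tau> fin q w), int (length (ys @ transduce \<tau> fin q w)) - 1)])"
  using assms(2)
proof (induction w arbitrary: q v ys)
  case Nil
  let ?c = "cells (map bit_symbol v)"
  have B: "length (fin q) \<le> B" using assms(1) Nil by (simp add: is_transducer_def)
  have rd: "?c (int (length v)) = 0" using cells_end(1)[of "map bit_symbol v"] by simp
  have 1: "step T (to_nat (Scan q), (?c, int (length v)) # mid @ [(cells ys, int (length ys))]) =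
    (to_nat (Emit None (fin q) :: 'q tstate), (?c, int (length v) - 1) # mid @ [(cells ys, int (length ys))])"
    by (simp add: transducer_step rd fun_upd_idem del: cells_write)
  have 2: "step T (to_nat (Emit None [] :: 'q tstate), (?c, int (length v) - 1) # mid @
        [(cells (ys @ fin q), int (length (ys @ fin q)))]) =
    (to_nat (Rewind :: 'q tstate), (?c, int (length v) - 1) # mid @
        [(cells (ys @ fin q), int (length (ys @ fin q)) - 1)])"
    by (simp add: transducer_step fun_upd_idem del: cells_write)
  have "reach T (length (fin q) + 1)
      (to_nat (Emit None (fin q) :: 'q tstate), (?c, int (length v) - 1) # mid @ [(cells ys, int (length ys))])
      (to_nat (Rewind :: 'q tstate), (?c, int (length v) - 1) # mid @
        [(cells (ys @ fin q), int (length (ys @ fin q)) - 1)])"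
    by (rule reach_trans[OF transducer_emit reach_step[OF 2 reach_refl order_refl]]) simp
  from reach_step[OF 1 this, of "B + 2"] B show ?case by simp
next
  case (Cons b w)
  let ?c = "cells (map bit_symbol (v @ b # w))"
  define q' u where "q' = fst (\<tau> q b)" and "u = snd (\<tau> q b)"
  have B: "length u \<le> B" and q': "q' \<in> Q"
    using assms(1) Cons.prems by (simp_all add: is_transducer_def q'_def u_def)
  have rd: "cells (map bit_symbol v @ bit_symbol b # map bit_symbol w) (int (length v)) = bit_symbol b"
    using cells_append_nth[of "map bit_symbol v" "bit_symbol b" "map bit_symbol w"] by simp
  have 1: "step T (to_nat (Scan q), (?c, int (length v)) # mid @ [(cells ys, int (length ys))]) =
    (to_nat (Emit (Some q') u), (?c, int (length v) + 1) # mid @ [(cells ys, int (length ys))])"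
    by (simp add: transducer_step rd fun_upd_idem bit_symbol_range q'_def u_def del: cells_write)
  have 2: "step T (to_nat (Emit (Some q') []), (?c, int (length v) + 1) # mid @
        [(cells (ys @ u), int (length (ys @ u)))]) =
    (to_nat (Scan q'), (?c, int (length v) + 1) # mid @ [(cells (ys @ u), int (length (ys @ u)))])"
    by (simp add: transducer_step fun_upd_idem del: cells_write)
  let ?goal = "(to_nat (Rewind :: 'q tstate), (?c, int (length (v @ b # w)) - 1) #
        mid @ [(cells (ys @ transduce \<tau> fin q (b # w)),
          int (length (ys @ transduce \<tau> fin q (b # w))) - 1)])"
  have "reach T ((B + 2) * (length w + 1)) (to_nat (Scan q'), (?c, int (length v) + 1) # mid @
        [(cells (ys @ u), int (length (ys @ u)))]) ?goal"
    using Cons.IH[OF q', of "v @ [b]" "ys @ u"] by (simp add: q'_def u_def add.commute)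
  from reach_step[OF 2 this order_refl]
  have "reach T (length u + Suc ((B + 2) * (length w + 1)))
      (to_nat (Emit (Some q') u), (?c, int (length v) + 1) # mid @ [(cells ys, int (length ys))]) ?goal"
    by (rule reach_trans[OF transducer_emit _ order_refl])
  from reach_step[OF 1 this, of "(B + 2) * (length (b # w) + 1)"] B show ?case by simp
qed

text \<open>Both heads run to the left independently and wait on the blank cell \<open>-1\<close> for each other.\<close>

lemma transducer_rewind:
  assumes "0 \<notin> set xs" "0 \<notin> set ys" "-1 \<le> p" "p < int (length xs)" "-1 \<le> r" "r < int (length ys)"
    and "p < int n" "r < int n"
  shows "reach T (n + 1) (to_nat (Rewind :: 'q tstate), (cells xs, p) # mid @ [(cells ys, r)])
     (to_nat (Done :: 'q tstate), (cells xs, 0) # mid @ [(cells ys, 0)])"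
  using assms(3-8)
proof (induction n arbitrary: p r)
  case 0
  then have "p = -1" "r = -1" by auto
  moreover have "step T (to_nat (Rewind :: 'q tstate), (cells xs, -1) # mid @ [(cells ys, -1)]) =
     (to_nat (Done :: 'q tstate), (cells xs, 0) # mid @ [(cells ys, 0)])"
    by (simp add: transducer_step fun_upd_idem)
  ultimately show ?case by (simp add: reach_one)
next
  case (Suc n)
  have zero: "cells zs j = 0 \<longleftrightarrow> j = -1" if "0 \<notin> set zs" "-1 \<le> j" "j < int (length zs)" for zs j
    using cells_nonzero[OF that(1), of j] that by (cases "j = -1") auto
  have x0: "cells xs p = 0 \<longleftrightarrow> p = -1" and y0: "cells ys r = 0 \<longleftrightarrow> r = -1"
    using zero[of xs p] zero[of ys r] assms(1,2) Suc.prems by simp_all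
  show ?case
  proof (cases "p = -1 \<and> r = -1")
    case True
    moreover have "step T (to_nat (Rewind :: 'q tstate), (cells xs, -1) # mid @ [(cells ys, -1)]) =
       (to_nat (Done :: 'q tstate), (cells xs, 0) # mid @ [(cells ys, 0)])"
      by (simp add: transducer_step fun_upd_idem)
    ultimately show ?thesis by (simp add: reach_one)
  next
    case False
    define p' r' where "p' = (if p = -1 then p else p - 1)" and "r' = (if r = -1 then r else r - 1)"
    have 1: "step T (to_nat (Rewind :: 'q tstate), (cells xs, p) # mid @ [(cells ys, r)]) =
       (to_nat (Rewind :: 'q tstate), (cells xs, p') # mid @ [(cells ys, r')])"
      using False by (simp add: transducer_step x0 y0 p'_def r'_def)
    have "reach T (n + 1) (to_nat (Rewind :: 'q tstate), (cells xs, p') # mid @ [(cells ys, r')])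
       (to_nat (Done :: 'q tstate), (cells xs, 0) # mid @ [(cells ys, 0)])"
      by (rule Suc.IH) (use Suc.prems in \<open>auto simp: p'_def r'_def\<close>)
    from reach_step[OF 1 this] show ?thesis by simp
  qed
qed

lemma transducer_reach:
  assumes "is_transducer Q \<tau> fin m B" "q0 \<in> Q" "(2 * B + 5) * (length x + 1) \<le> U"
  shows "reach T U (start T, word_tape x # mid @ [word_tape []])
     (exit_state T True, word_tape x # mid @ [(cells (transduce \<tau> fin q0 x), 0)])"
proof -
  let ?o = "transduce \<tau> fin q0 x"
  have o: "set ?o \<subseteq> {1..<m}" "length ?o \<le> B * (length x + 1)"
    using transduce_bounds[OF assms(1,2)] by blast+
  then have nz: "0 \<notin> set ?o" by auto
  have nzx: "0 \<notin> set (map bit_symbol x)" using bit_symbol_range(3) by (auto simp: image_iff)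
  let ?n = "length x + length ?o"
  have "reach T ((B + 2) * (length x + 1))
     (start T, word_tape x # mid @ [word_tape []])
     (to_nat (Rewind :: 'q tstate), (cells (map bit_symbol x), int (length x) - 1) #
        mid @ [(cells ?o, int (length ?o) - 1)])"
    using transducer_scan[OF assms(1,2), of x "[]" mid "[]"]
    by (simp add: word_tape_cells T_def transducer_def)
  moreover have "reach T (?n + 1)
     (to_nat (Rewind :: 'q tstate), (cells (map bit_symbol x), int (length x) - 1) #
        mid @ [(cells ?o, int (length ?o) - 1)])
     (to_nat (Done :: 'q tstate), (cells (map bit_symbol x), 0) # mid @ [(cells ?o, 0)])"
    by (rule transducer_rewind) (use nz nzx in auto)
  moreover have "(B + 2) * (length x + 1) + (?n + 1) \<le> U"
    using o(2) assms(3) by (simp add: algebra_simps)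
  ultimately have "reach T U (start T, word_tape x # mid @ [word_tape []])
     (to_nat (Done :: 'q tstate), (cells (map bit_symbol x), 0) # mid @ [(cells ?o, 0)])"
    by (rule reach_trans)
  then show ?thesis by (simp add: word_tape_cells T_def transducer_def)
qed

end

section \<open>Closure properties\<close>

lemma init_single: "init M [x] = (start M, map word_tape (x # replicate (tapes M - 1) []))"
  by (simp add: init_def)

lemma legal_words:
  assumes "wf_tm M" "length xs = tapes M"
  shows "legal M (start M, map word_tape xs)"
proof -
  have "bit_symbol b < symbols M" for b
    using wf_tm_parts(2)[OF assms(1)] bit_symbol_range(2)[of b] by linarith
  then have "fst (word_tape x) j < symbols M" for x j
    unfolding word_tape_cells fst_conv
    by (intro cells_bound) (use wf_tm_parts(2)[OF assms(1)] in auto)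
  then show ?thesis using assms wf_tm_parts(4)[OF assms(1)] by (simp add: legal_def)
qed

lemma class_P_iff:
  "L \<in> class_P \<longleftrightarrow> (\<exists>M (p :: nat poly). wf_tm M \<and>
     (\<forall>x. \<exists>ts. reach M (poly p (length x)) (init M [x]) (exit_state M (x \<in> L), ts)))"
proof -
  have "(x \<in> L \<longrightarrow> (\<exists>ts. reach M T c (exit_state M True, ts))) \<and>
      (x \<notin> L \<longrightarrow> (\<exists>ts. reach M T c (exit_state M False, ts))) \<longleftrightarrow>
      (\<exists>ts. reach M T c (exit_state M (x \<in> L), ts))" for M T c x
    by (cases "x \<in> L") auto
  then show ?thesis unfolding class_P_def exits_within_iff by auto
qed

text \<open>A machine destroys its input, so the second machine gets a copy of it, made by the identity
  transducer before the first one starts.\<close>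

lemma class_P_Un:
  assumes "L1 \<in> class_P" "L2 \<in> class_P"
  shows "L1 \<union> L2 \<in> class_P"
proof -
  obtain M1 M2 and p1 p2 :: "nat poly" where wf: "wf_tm M1" "wf_tm M2"
    and r1: "\<And>x. \<exists>ts. reach M1 (poly p1 (length x)) (init M1 [x]) (exit_state M1 (x \<in> L1), ts)"
    and r2: "\<And>x. \<exists>ts. reach M2 (poly p2 (length x)) (init M2 [x]) (exit_state M2 (x \<in> L2), ts)"
    using assms unfolding class_P_iff by blast
  define k1 k2 K m where "k1 = tapes M1" and "k2 = tapes M2" and "K = k1 + k2"
    and "m = max (symbols M1) (symbols M2)"
  note parts = wf_tm_parts[OF wf(1)] wf_tm_parts[OF wf(2)]
  have k: "1 \<le> k1" "1 \<le> k2" and m: "3 \<le> m" "symbols M1 \<le> m" "symbols M2 \<le> m"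
    using parts by (simp_all add: k1_def k2_def m_def)
  define \<tau> :: "unit \<Rightarrow> bool \<Rightarrow> unit \<times> nat list" where "\<tau> = (\<lambda>_ b. ((), [bit_symbol b]))"
  define fin :: "unit \<Rightarrow> nat list" where "fin = (\<lambda>_. [])"
  have tr: "is_transducer UNIV \<tau> fin m 1"
    using m(1) bit_symbol_range(1,2) by (auto simp: is_transducer_def \<tau>_def fin_def le_less_trans[of _ 2])
  have out: "transduce \<tau> fin () x = map bit_symbol x" for x
    by (induction x) (auto simp: \<tau>_def fin_def)
  define C where "C = transducer (k1 + 1) m UNIV \<tau> fin 1 ()"
  have C: "wf_tm C" "tapes C = k1 + 1" "symbols C = m"
    using wf_transducer[OF tr] k(1) m(1) by (simp_all add: C_def)
  define N1 N2 N3 N where "N1 = on_tapes 0 K m M1" and "N2 = on_tapes k1 K m M2"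
    and "N3 = branch False N1 N2" and "N = branch True (on_tapes 0 K m C) N3"
  have wfN: "wf_tm N1" "wf_tm N2"
    unfolding N1_def N2_def
    by (rule wf_on_tapes; use wf m in \<open>simp add: K_def k1_def k2_def\<close>)+
  have wfN3: "wf_tm N3" "tapes N3 = K" "symbols N3 = m"
    unfolding N3_def by (simp_all add: wf_branch wfN) (simp_all add: N1_def N2_def wf_branch wfN[unfolded N1_def N2_def])
  have wfC: "wf_tm (on_tapes 0 K m C)"
    by (rule wf_on_tapes) (use C k in \<open>simp_all add: K_def\<close>)
  have wfN': "wf_tm N" "tapes N = K"
    unfolding N_def using wfC wfN3 by (simp_all add: wf_branch)
  define p where "p = [:7:] * [:1, 1:] + p1 + p2 + [:2:]"
  have "\<exists>ts. reach N (poly p (length x)) (init N [x]) (exit_state N (x \<in> L1 \<union> L2), ts)" for x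
  proof -
    let ?n = "length x"
    let ?b1 = "map word_tape (replicate (k1 - 1) [])" and ?b2 = "map word_tape (replicate (k2 - 1) [])"
    have i1: "init M1 [x] = (start M1, word_tape x # ?b1)"
      and i2: "init M2 [x] = (start M2, word_tape x # ?b2)"
      by (simp_all add: init_single k1_def k2_def)
    have l1: "legal M1 (start M1, word_tape x # ?b1)"
      using legal_words[OF wf(1), of "x # replicate (k1 - 1) []"] k by (simp add: k1_def)
    have l2: "legal M2 (start M2, word_tape x # ?b2)"
      using legal_words[OF wf(2), of "x # replicate (k2 - 1) []"] k by (simp add: k2_def)
    have lC: "legal C (start C, word_tape x # ?b1 @ [word_tape []])"
      using legal_words[OF C(1), of "x # replicate (k1 - 1) [] @ [[]]"] k C(2) by simp
    have "K - 1 = (k1 - 1) + 1 + (k2 - 1)" using k by (simp add: K_def)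
    then have iN: "init N [x] = (start N, (word_tape x # ?b1 @ [word_tape []]) @ ?b2)"
      by (simp add: init_single wfN'(2) replicate_add replicate_append_same)
    have "reach C (7 * (?n + 1)) (start C, word_tape x # ?b1 @ [word_tape []])
        (exit_state C True, word_tape x # ?b1 @ [word_tape x])"
      using transducer_reach[OF tr, of "()" x "7 * (?n + 1)" "k1 + 1" ?b1]
      by (simp add: C_def out word_tape_cells)
    from reach_on_tapes[OF C(1) lC _ this, of "[]" 0 K m ?b2]
    have copy: "reach (on_tapes 0 K m C) (7 * (?n + 1))
        (start (on_tapes 0 K m C), (word_tape x # ?b1 @ [word_tape []]) @ ?b2)
        (exit_state (on_tapes 0 K m C) True, (word_tape x # ?b1) @ word_tape x # ?b2)"
      by simp
    obtain us where "reach M1 (poly p1 ?n) (start M1, word_tape x # ?b1) (exit_state M1 (x \<in> L1), us)"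
      using r1[of x] unfolding i1 by blast
    from reach_on_tapes[OF wf(1) l1 _ this, of "[]" 0 K m "word_tape x # ?b2"]
    have run1: "reach N1 (poly p1 ?n) (start N1, (word_tape x # ?b1) @ word_tape x # ?b2)
        (exit_state N1 (x \<in> L1), us @ word_tape x # ?b2)"
      by (simp add: N1_def)
    have "\<exists>vs. reach N3 (poly p1 ?n + poly p2 ?n + 1)
        (start N3, (word_tape x # ?b1) @ word_tape x # ?b2) (exit_state N3 (x \<in> L1 \<union> L2), vs)"
    proof (cases "x \<in> L1")
      case True
      then have "reach N1 (poly p1 ?n) (start N1, (word_tape x # ?b1) @ word_tape x # ?b2)
        (exit_state N1 (\<not> False), us @ word_tape x # ?b2)"
        using run1 by simp
      from reach_branch_stop[OF this wf_tm_parts(6)[OF wfN(1)], of "poly p1 ?n + poly p2 ?n + 1" N2]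
      show ?thesis using True unfolding N3_def by auto
    next
      case False
      obtain vs where "reach M2 (poly p2 ?n) (start M2, word_tape x # ?b2) (exit_state M2 (x \<in> L2), vs)"
        using r2[of x] unfolding i2 by blast
      have us: "length us = k1"
      proof -
        obtain t where t: "(step M1 ^^ t) (start M1, word_tape x # ?b1) = (exit_state M1 (x \<in> L1), us)"
          using \<open>reach M1 _ _ _\<close> unfolding reach_def by blast
        show ?thesis using funpow_step_legal[OF wf(1) l1, of t] unfolding t
          by (simp add: legal_def k1_def)
      qed
      from reach_on_tapes[OF wf(2) l2 us \<open>reach M2 _ _ _\<close>, of K m "[]"]
      have run2: "reach N2 (poly p2 ?n) (start N2, us @ word_tape x # ?b2)
          (exit_state N2 (x \<in> L2), us @ vs)"
        by (simp add: N2_def)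
      have "reach N1 (poly p1 ?n) (start N1, (word_tape x # ?b1) @ word_tape x # ?b2)
        (exit_state N1 False, us @ word_tape x # ?b2)"
        using run1 False by simp
      from reach_branch_continue[OF this run2, of "poly p1 ?n + poly p2 ?n + 1"]
      have "reach N3 (poly p1 ?n + poly p2 ?n + 1)
          (start N3, (word_tape x # ?b1) @ word_tape x # ?b2) (2 * exit_state N2 (x \<in> L2) + 1, us @ vs)"
        unfolding N3_def by simp
      then show ?thesis using False unfolding N3_def by auto
    qed
    then obtain vs where run3: "reach N3 (poly p1 ?n + poly p2 ?n + 1)
        (start N3, (word_tape x # ?b1) @ word_tape x # ?b2) (exit_state N3 (x \<in> L1 \<union> L2), vs)"
      by blast
    have "7 * (?n + 1) + (poly p1 ?n + poly p2 ?n + 1) + 1 \<le> poly p ?n"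
      by (simp add: p_def algebra_simps)
    from reach_branch_continue[OF copy run3 this]
    show ?thesis unfolding iN by (auto simp: N_def)
  qed
  then show ?thesis using wfN'(1) unfolding class_P_iff by blast
qed

text \<open>In \<open>t\<close> steps a machine moves each head by at most \<open>t\<close> cells, so it writes at most \<open>t\<close>
  cells beyond its input.\<close>

lemma output_length:
  assumes "wf_tm M" "outputs_within M x y T"
  shows "length y \<le> length x + T"
proof -
  obtain t ts where t: "t \<le> T" "(step M ^^ t) (init M [x]) = (accept M, ts)" "last ts = word_tape y"
    using assms(2) unfolding outputs_within_def by blast
  define near where "near n = (\<lambda>u :: tape. snd u \<le> int n \<and> (\<forall>j. fst u j \<noteq> 0 \<longrightarrow> j < int (length x + n)))" for n
  have word: "near 0 (word_tape z)" if "length z \<le> length x" for z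
    using that by (auto simp: near_def word_tape_def)
  have act: "near (Suc n) (act_tape a u)" if "near n u" for n a u
  proof -
    obtain s d where a: "a = (s, d)" by fastforce
    obtain c q where u: "u = (c, q)" by fastforce
    have "shift d q \<le> q + 1" by (cases d) auto
    then show ?thesis using that by (auto simp: near_def a u) (smt (verit))+
  qed
  have "\<forall>u\<in>set (snd ((step M ^^ n) (init M [x]))). near n u" for n
  proof (induction n)
    case 0
    show ?case using word by (auto simp: init_def)
  next
    case (Suc n)
    obtain q us where q: "(step M ^^ n) (init M [x]) = (q, us)" by fastforce
    have us: "near n u" if "u \<in> set us" for u using Suc.IH q that by simp
    have mono: "near (Suc n) u" if u: "near n u" for u
    proof -
      have "j < int (length x + Suc n)" if "fst u j \<noteq> 0" for j
      proof -
        have "j < int (length x + n)" using u that by (simp add: near_def)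
        then show ?thesis by simp
      qed
      then show ?thesis using u by (simp add: near_def)
    qed
    have "near (Suc n) v" if v: "v \<in> set (snd (step M (q, us)))" for v
    proof (cases "q = accept M \<or> q = reject M")
      case True
      then show ?thesis using v us mono by (simp add: step.simps)
    next
      case False
      then obtain acts where "v \<in> set (map2 act_tape acts us)"
        using v by (auto simp: step.simps split: prod.splits)
      then obtain z where "z \<in> set (zip acts us)" "v = act_tape (fst z) (snd z)"
        unfolding set_map by (metis (no_types, lifting) case_prod_beta imageE)
      then show ?thesis using act us by (metis prod.collapse set_zip_rightD)
    qed
    then show ?case using q by simp
  qed
  from this[of t] have near: "\<forall>u\<in>set ts. near t u" using t(2) by simp
  show ?thesis
  proof (cases "y = []")
    case False
    have "legal M (init M [x])"
      using legal_words[OF assms(1), of "x # replicate (tapes M - 1) []"] wf_tm_parts(1)[OF assms(1)]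
      by (simp add: init_single)
    from funpow_step_legal[OF assms(1) this, of t] have "ts \<noteq> []"
      using wf_tm_parts(1)[OF assms(1)] unfolding t(2) by (auto simp: legal_def)
    then have "near t (word_tape y)" using near t(3) by (metis last_in_set)
    moreover have "fst (word_tape y) (int (length y - 1)) \<noteq> 0"
      using False by (simp add: word_tape_def bit_symbol_range)
    ultimately have "int (length y - 1) < int (length x + t)" by (simp add: near_def)
    then show ?thesis using t(1) False by simp
  qed simp
qed

text \<open>The value left by the first machine on its last tape is the input of the transducer, which writes on a
  fresh tape. Its running time is linear in the length of that value, which is bounded by
  \<open>output_length\<close>.\<close>

lemma poly_time_transduce:
  assumes f: "poly_time_computable f"
    and tr: "is_transducer Q \<tau> fin 3 B" "q0 \<in> (Q :: 'q::countable set)"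
    and out: "\<And>x. transduce \<tau> fin q0 x = map bit_symbol (g x)"
  shows "poly_time_computable (\<lambda>x. g (f x))"
proof -
  obtain M and p :: "nat poly" where wf: "wf_tm M"
    and M: "\<And>x. outputs_within M x (f x) (poly p (length x))"
    using f unfolding poly_time_computable_def by blast
  define k m where "k = tapes M" and "m = symbols M"
  note parts = wf_tm_parts[OF wf]
  have k: "1 \<le> k" and m: "3 \<le> m" using parts by (simp_all add: k_def m_def)
  define C where "C = transducer 2 3 Q \<tau> fin B q0"
  have C: "wf_tm C" "tapes C = 2" "symbols C = 3"
    using wf_transducer[OF tr] by (simp_all add: C_def)
  define N1 N2 N where "N1 = on_tapes 0 (k + 1) m M" and "N2 = on_tapes (k - 1) (k + 1) m C"
    and "N = branch True N1 N2"
  have wfN: "wf_tm N1" "wf_tm N2"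
    unfolding N1_def N2_def
    by (rule wf_on_tapes; use wf C k m in \<open>simp add: k_def m_def\<close>)+
  have tapesN: "tapes N1 = k + 1" "tapes N2 = k + 1" "symbols N1 = m" "symbols N2 = m"
    by (simp_all add: N1_def N2_def)
  have N: "wf_tm N" "tapes N = k + 1"
    unfolding N_def using wfN tapesN by (simp_all add: wf_branch)
  define r where "r = p + [:2 * B + 5:] * ([:1, 1:] + p) + [:1:]"
  have "outputs_within N x (g (f x)) (poly r (length x))" for x
  proof -
    let ?n = "length x"
    obtain ts where run: "reach M (poly p ?n) (init M [x]) (exit_state M True, ts)"
      and last: "last ts = word_tape (f x)"
      using M[of x] unfolding outputs_within_def reach_def exit_state_def by auto
    let ?b = "map word_tape (replicate (k - 1) [])"
    have iM: "init M [x] = (start M, word_tape x # ?b)"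
      by (simp add: init_single k_def)
    have lM: "legal M (start M, word_tape x # ?b)"
      using legal_words[OF wf, of "x # replicate (k - 1) []"] k by (simp add: k_def)
    have "k = (k - 1) + 1" using k by simp
    then have "replicate k [] = replicate (k - 1) [] @ [[] :: bool list]"
      by (metis replicate_add replicate_0 replicate_Suc One_nat_def)
    then have iN: "init N [x] = (start N, (word_tape x # ?b) @ [word_tape []])"
      by (simp add: init_single N(2))
    have run1: "reach N1 (poly p ?n) (start N1, (word_tape x # ?b) @ [word_tape []])
        (exit_state N1 True, ts @ [word_tape []])"
      using reach_on_tapes[OF wf lM _ run[unfolded iM], of "[]" 0 "k + 1" m "[word_tape []]"]
      by (simp add: N1_def)
    obtain t where t: "(step M ^^ t) (start M, word_tape x # ?b) = (exit_state M True, ts)"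
      using run unfolding iM reach_def by blast
    have len: "length ts = k" using funpow_step_legal[OF wf lM, of t] unfolding t
      by (simp add: legal_def k_def)
    define pre where "pre = butlast ts"
    have pre: "ts = pre @ [word_tape (f x)]" "length pre = k - 1"
      using len k last unfolding pre_def by (metis append_butlast_last_id length_greater_0_conv less_le_trans zero_less_one, simp)
    have lC: "legal C (start C, [word_tape (f x), word_tape []])"
      using legal_words[OF C(1), of "[f x, []]"] C(2) by simp
    let ?T = "(2 * B + 5) * (length (f x) + 1)"
    have "reach C ?T (start C, [word_tape (f x), word_tape []])
        (exit_state C True, [word_tape (f x), word_tape (g (f x))])"
      using transducer_reach[OF tr, of "f x" ?T 2 "[]"]
      by (simp add: C_def out word_tape_cells)
    from reach_on_tapes[OF C(1) lC pre(2) this, of "k + 1" m "[]"]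
    have run2: "reach N2 ?T (start N2, ts @ [word_tape []])
        (exit_state N2 True, pre @ [word_tape (f x), word_tape (g (f x))])"
      by (simp add: N2_def pre(1))
    have "length (f x) \<le> ?n + poly p ?n" using output_length[OF wf M] .
    then have "?T \<le> (2 * B + 5) * (?n + poly p ?n + 1)" by (intro mult_le_mono) auto
    then have "poly p ?n + ?T + 1 \<le> poly r ?n"
      by (simp add: r_def algebra_simps)
    from reach_branch_continue[OF run1 run2 this]
    have "reach N (poly r ?n) (init N [x])
        (exit_state N True, pre @ [word_tape (f x), word_tape (g (f x))])"
      unfolding iN by (simp add: N_def)
    then show ?thesis unfolding outputs_within_def reach_def exit_state_def by force
  qed
  then show ?thesis using N(1) unfolding poly_time_computable_def by blast
qed

section \<open>Codes of structures\<close>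

definition well_typed :: "'i set \<Rightarrow> ('i \<Rightarrow> nat) \<Rightarrow> ('i \<times> nat list) list \<Rightarrow> bool" where
  "well_typed I \<delta> ts \<longleftrightarrow> (\<forall>(i, t)\<in>set ts. i \<in> I \<and> length t = \<delta> i)"

definition below :: "nat \<Rightarrow> ('i \<times> nat list) list \<Rightarrow> bool" where
  "below n ts \<longleftrightarrow> 0 < n \<and> (\<forall>(i, t)\<in>set ts. set t \<subseteq> {..<n})"

definition maps_into :: "nat \<Rightarrow> ('i \<times> nat list) list \<Rightarrow> ('a, 'i) rstruct \<Rightarrow> (nat \<Rightarrow> 'a) \<Rightarrow> bool" where
  "maps_into n ts H h \<longleftrightarrow> h ` {..<n} \<subseteq> base H \<and> (\<forall>(i, t)\<in>set ts. map h t \<in> rel H i)"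

text \<open>Structures are replaced by the tuple lists in their codes, on which machines operate.\<close>

lemma GCSP_iff:
  fixes I :: "'i::countable set"
  shows "w \<in> GCSP I \<delta> \<H> \<longleftrightarrow>
    (\<exists>n ts. w = encode n ts \<and> well_typed I \<delta> ts \<and> below n ts \<and> (\<exists>H\<in>\<H>. \<exists>h. maps_into n ts H h))"
proof
  assume "w \<in> GCSP I \<delta> \<H>"
  then obtain G H h where G: "codes I \<delta> w G" and H: "H \<in> \<H>" "is_hom I G H h"
    unfolding GCSP_def hom_to_def by blast
  then obtain n ts where ts: "w = encode n ts" "base G = {..<n}" "fst ` set ts \<subseteq> I"
    "\<forall>i\<in>I. rel G i = {t. (i, t) \<in> set ts}" and s: "is_structure I \<delta> G"
    unfolding codes_def by blast
  have *: "i \<in> I \<and> t \<in> rel G i" if "(i, t) \<in> set ts" for i t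
    using that ts(3,4) by force
  have shape: "length t = \<delta> i \<and> set t \<subseteq> {..<n}" if "(i, t) \<in> set ts" for i t
    using *[OF that] s ts(2) unfolding is_structure_def by auto
  have "well_typed I \<delta> ts" using * shape unfolding well_typed_def by blast
  moreover have "below n ts"
    using shape s ts(2) unfolding below_def is_structure_def by (auto simp: lessThan_empty_iff)
  moreover have "maps_into n ts H h"
    using * H(2) ts(2) unfolding maps_into_def is_hom_def by auto
  ultimately show "\<exists>n ts. w = encode n ts \<and> well_typed I \<delta> ts \<and> below n ts \<and>
      (\<exists>H\<in>\<H>. \<exists>h. maps_into n ts H h)"
    using ts(1) H(1) by blast
next
  assume "\<exists>n ts. w = encode n ts \<and> well_typed I \<delta> ts \<and> below n ts \<and> (\<exists>H\<in>\<H>. \<exists>h. maps_into n ts H h)"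
  then obtain n ts H h where w: "w = encode n ts" "well_typed I \<delta> ts" "below n ts"
    and H: "H \<in> \<H>" "maps_into n ts H h"
    by blast
  define G :: "(nat, 'i) rstruct" where "G = \<lparr>base = {..<n}, rel = \<lambda>i. {t. (i, t) \<in> set ts}\<rparr>"
  have "is_structure I \<delta> G"
    using w(2,3) unfolding is_structure_def well_typed_def below_def G_def by fastforce
  moreover have "fst ` set ts \<subseteq> I" using w(2) unfolding well_typed_def by auto
  ultimately have "codes I \<delta> w G" using w(1) unfolding codes_def by (auto simp: G_def)
  moreover have "is_hom I G H h" using H(2) unfolding is_hom_def maps_into_def G_def by auto
  ultimately show "w \<in> GCSP I \<delta> \<H>" using H(1) unfolding GCSP_def hom_to_def by blast
qed

lemma CSP_eq_GCSP: "CSP I \<delta> H = GCSP I \<delta> {H}"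
  unfolding CSP_def GCSP_def by simp

lemma GCSP_insert: "GCSP I \<delta> (insert H \<H>) = CSP I \<delta> H \<union> GCSP I \<delta> \<H>"
  unfolding CSP_def GCSP_def by blast

lemma encode_inj:
  fixes ts us :: "('i::countable \<times> nat list) list"
  assumes "encode n ts = encode m us" "well_typed I \<delta> ts" "well_typed I \<delta> us"
  shows "n = m \<and> ts = us"
proof -
  have "n = m" "concat (map encode_tuple ts) = concat (map encode_tuple us)"
    using assms(1) unfolding encode_def unary_append_eq_iff by simp_all
  moreover have "\<forall>(i, t)\<in>set ts. length t = \<delta> i" "\<forall>(i, t)\<in>set us. length t = \<delta> i"
    using assms(2,3) unfolding well_typed_def by auto
  ultimately show ?thesis using concat_encode_tuple_inj by blast
qed

lemma unary_simps: "unary 0 = [False]" "unary (Suc n) = True # unary n"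
  by (simp_all add: unary_def)

lemma unary_add: "replicate m True @ unary n = unary (m + n)"
  by (simp add: unary_def replicate_add)

lemma unary_prefix:
  assumes "False \<in> set w"
  obtains d w' where "w = unary d @ w'"
proof -
  have "\<exists>d w'. w = unary d @ w'"
    using assms
  proof (induction w)
    case (Cons b w)
    show ?case
    proof (cases b)
      case True
      then obtain d w' where "w = unary d @ w'" using Cons by auto
      then have "b # w = unary (Suc d) @ w'" using True by (simp add: unary_simps)
      then show ?thesis by blast
    next
      case False
      then have "b # w = unary 0 @ w" by (simp add: unary_simps)
      then show ?thesis by blast
    qed
  qed simp
  then show ?thesis using that by blast
qed

lemma encode_ends_False: "\<exists>u. encode n ts = u @ [False]"
proof -
  have un: "\<exists>u. unary k = u @ [False]" for k by (simp add: unary_def)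
  have app: "\<exists>u. v @ w = u @ [False]" if "\<exists>u. w = u @ [False]" for v w
    using that by force
  have many: "xs \<noteq> [] \<Longrightarrow> \<exists>u. concat (map unary xs) = u @ [False]" for xs
    by (induction xs rule: rev_induct) (use un app in auto)
  have tup: "\<exists>u. encode_tuple (i, t) = u @ [False]" for i :: 'a and t
    by (cases "t = []") (use un app many in auto)
  have "ts \<noteq> [] \<Longrightarrow> \<exists>u. concat (map encode_tuple ts) = u @ [False]"
    by (induction ts rule: rev_induct) (use tup app in auto)
  then show ?thesis unfolding encode_def by (cases "ts = []") (use un app in auto)
qed

text \<open>The words that list tuples are recognised by an automaton. In \<open>Idx k\<close> it has read \<open>k\<close> letters of the
  unary index that starts a tuple; in \<open>Elem k vs\<close> it is inside a tuple of the relation with index \<open>k\<close>, and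
  \<open>vs\<close> are the values found for the elements already completed.\<close>

datatype pstate = Idx nat | Elem nat "nat list"

context
  fixes I :: "'i::countable set" and \<delta> :: "'i \<Rightarrow> nat"
begin

definition indices :: "nat set" where
  "indices = to_nat ` I"

definition arity :: "nat \<Rightarrow> nat" where
  "arity k = \<delta> (from_nat k)"

lemma indices_simps [simp]: "i \<in> I \<Longrightarrow> to_nat i \<in> indices" "arity (to_nat i) = \<delta> i"
  by (simp_all add: indices_def arity_def)

text \<open>The number \<open>e\<close> counts the letters read of the current element; \<open>lk\<close> maps elements to values, and \<open>ok\<close>
  judges the values of a complete tuple. The verifier follows this recursion with the table of a
  certificate as \<open>lk\<close>, whereas the transducer of the reduction needs only the format of the word, which
  is the case of constant \<open>lk\<close> and \<open>ok\<close>. Indices too large for \<open>I\<close> are refused while they are being read,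
  since a machine has only finitely many states \<open>Idx k\<close>.\<close>

fun reads :: "(nat \<Rightarrow> nat option) \<Rightarrow> (nat \<Rightarrow> nat list \<Rightarrow> bool) \<Rightarrow> pstate \<Rightarrow> nat \<Rightarrow> bool list \<Rightarrow> bool" where
  "reads lk ok s e [] \<longleftrightarrow> s = Idx 0"
| "reads lk ok (Idx k) e (True # w) \<longleftrightarrow> (\<exists>j\<in>indices. k < j) \<and> reads lk ok (Idx (Suc k)) e w"
| "reads lk ok (Idx k) e (False # w) \<longleftrightarrow> k \<in> indices \<and> reads lk ok (Elem k []) 0 w"
| "reads lk ok (Elem k vs) e (True # w) \<longleftrightarrow> reads lk ok (Elem k vs) (Suc e) w"
| "reads lk ok (Elem k vs) e (False # w) \<longleftrightarrow> (case lk e of None \<Rightarrow> False | Some v \<Rightarrow>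
     if length vs + 1 < arity k then reads lk ok (Elem k (vs @ [v])) 0 w
     else ok k (vs @ [v]) \<and> reads lk ok (Idx 0) 0 w)"

lemma reads_Idx_unary:
  "reads lk ok (Idx k) e (unary j @ w) \<longleftrightarrow> k + j \<in> indices \<and> reads lk ok (Elem (k + j) []) 0 w"
proof (induction j arbitrary: k)
  case (Suc j)
  have "\<exists>j'\<in>indices. k < j'" if "Suc k + j \<in> indices" using that by (intro bexI[of _ "Suc k + j"]) auto
  then show ?case using Suc[of "Suc k"] by (auto simp: unary_simps)
qed (simp add: unary_simps)

lemma reads_Elem_unary:
  "reads lk ok (Elem k vs) e (unary d @ w) \<longleftrightarrow> reads lk ok (Elem k vs) (e + d) (False # w)"
proof (induction d arbitrary: e)
  case (Suc d)
  then show ?case using Suc[of "Suc e"] by (simp add: unary_simps)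
qed (simp add: unary_simps)

lemma reads_Elem_list:
  assumes "t \<noteq> []" "length vs + length t = arity k"
  shows "reads lk ok (Elem k vs) 0 (concat (map unary t) @ w) \<longleftrightarrow>
    (\<forall>x\<in>set t. lk x \<noteq> None) \<and> ok k (vs @ map (\<lambda>x. the (lk x)) t) \<and> reads lk ok (Idx 0) 0 w"
  using assms
proof (induction t arbitrary: vs)
  case (Cons d t)
  show ?case
  proof (cases "t = []")
    case True
    then show ?thesis using Cons.prems by (auto simp: reads_Elem_unary split: option.splits)
  next
    case False
    then have "length vs + 1 < arity k" using Cons.prems(2) by (cases t) auto
    then show ?thesis using Cons.IH[OF False] Cons.prems(2)
      by (auto simp: reads_Elem_unary split: option.splits)
  qed
qed simp

lemma reads_False:
  "reads lk ok s e w \<Longrightarrow> s = Idx 0 \<and> w = [] \<or> False \<in> set w"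
  by (induction lk ok s e w rule: reads.induct) auto

lemma reads_Elem_split:
  assumes "reads lk ok (Elem k vs) 0 w" "length vs < arity k"
  shows "\<exists>t w'. w = concat (map unary t) @ w' \<and> t \<noteq> [] \<and> length vs + length t = arity k"
  using assms
proof (induction "arity k - length vs" arbitrary: vs w)
  case (Suc n)
  obtain d w' where w: "w = unary d @ w'" using reads_False[OF Suc.prems(1)] unary_prefix by blast
  show ?case
  proof (cases "length vs + 1 < arity k")
    case True
    then obtain v where "reads lk ok (Elem k (vs @ [v])) 0 w'"
      using Suc.prems(1) unfolding w by (auto simp: reads_Elem_unary split: option.splits)
    moreover have "n = arity k - length (vs @ [v])" using Suc.hyps(2) by simp
    ultimately obtain t w'' where t: "w' = concat (map unary t) @ w''" "length (vs @ [v]) + length t = arity k"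
      using Suc.hyps(1)[of "vs @ [v]" w'] True by auto
    then show ?thesis using w by (intro exI[of _ "d # t"] exI[of _ w'']) auto
  next
    case False
    then show ?thesis using w Suc.prems(2) by (intro exI[of _ "[d]"] exI[of _ w']) auto
  qed
qed simp

text \<open>As arities are positive, a tuple is complete exactly when its last element is, and the word splits
  uniquely into tuples.\<close>

lemma reads_iff:
  assumes "is_type I \<delta>"
  shows "reads lk ok (Idx 0) e w \<longleftrightarrow> (\<exists>ts. w = concat (map encode_tuple ts) \<and> well_typed I \<delta> ts \<and>
    (\<forall>(i, t)\<in>set ts. (\<forall>x\<in>set t. lk x \<noteq> None) \<and> ok (to_nat i) (map (\<lambda>x. the (lk x)) t)))"
    (is "_ \<longleftrightarrow> (\<exists>ts. ?P w ts)")
proof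
  have ar: "0 < \<delta> i" if "i \<in> I" for i using assms that unfolding is_type_def by fastforce
  show "\<exists>ts. ?P w ts" if "reads lk ok (Idx 0) e w"
    using that
  proof (induction w arbitrary: e rule: length_induct)
    case (1 w)
    show ?case
    proof (cases "w = []")
      case True
      then show ?thesis by (intro exI[of _ "[]"]) (simp add: well_typed_def)
    next
      case False
      then obtain j w1 where w: "w = unary j @ w1"
        using reads_False[OF 1(2)] unary_prefix by blast
      then have "j \<in> indices" and r1: "reads lk ok (Elem j []) 0 w1"
        using 1(2) by (simp_all add: reads_Idx_unary)
      then obtain i where i: "i \<in> I" "j = to_nat i" by (auto simp: indices_def)
      then obtain t w2 where w1: "w1 = concat (map unary t) @ w2" and t: "t \<noteq> []" "length t = \<delta> i"
        using reads_Elem_split[OF r1] ar by auto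
      have r2: "(\<forall>x\<in>set t. lk x \<noteq> None) \<and> ok j (map (\<lambda>x. the (lk x)) t)" "reads lk ok (Idx 0) 0 w2"
        using r1 reads_Elem_list[OF t(1), of "[]" j lk ok w2] t(2) unfolding w1 i(2) by simp_all
      have "length w2 < length w" by (simp add: w w1 unary_def)
      then obtain ts where ts: "?P w2 ts" using 1(1) r2(2) by blast
      have "w = concat (map encode_tuple ((i, t) # ts))" using ts by (simp add: w w1 i(2))
      moreover have "well_typed I \<delta> ((i, t) # ts)" using ts i t by (simp add: well_typed_def)
      ultimately show ?thesis using ts r2(1) i(2) by (intro exI[of _ "(i, t) # ts"]) simp
    qed
  qed
  have "reads lk ok (Idx 0) e (concat (map encode_tuple ts))" if "?P (concat (map encode_tuple ts)) ts" for ts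
    using that
  proof (induction ts arbitrary: e)
    case (Cons x ts)
    obtain i t where x: "x = (i, t)" by (cases x)
    have it: "i \<in> I" "length t = \<delta> i" using Cons.prems by (simp_all add: x well_typed_def)
    then have "t \<noteq> []" using ar by fastforce
    then show ?case using Cons it
      by (simp add: x well_typed_def reads_Idx_unary reads_Elem_list)
  qed simp
  then show "reads lk ok (Idx 0) e w" if "\<exists>ts. ?P w ts" using that by blast
qed

end

section \<open>Adding a disjoint copy of a structure\<close>

datatype rstate = Start | Size | RIdx nat | RElem nat nat | Dead

instance rstate :: countable by countable_datatype

context
  fixes I :: "'i::countable set" and \<delta> :: "'i \<Rightarrow> nat" and m :: nat and E :: "('i \<times> nat list) list"
begin

text \<open>Here \<open>E\<close> lists the tuples of a structure on \<open>{0, \<dots>, m - 1}\<close>. The initial state is left only with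
  the letter True: a structure without elements has no code, but adding the other structure would make it one.\<close>

fun add_step :: "rstate \<Rightarrow> bool \<Rightarrow> rstate \<times> bool list" where
  "add_step Start True = (Size, replicate (Suc m) True)"
| "add_step Size True = (Size, [True])"
| "add_step Size False = (RIdx 0, False # concat (map encode_tuple E))"
| "add_step (RIdx k) True = (if \<exists>j\<in>indices I. k < j then (RIdx (Suc k), [True]) else (Dead, []))"
| "add_step (RIdx k) False =
     (if k \<in> indices I then (RElem k 0, False # replicate m True) else (Dead, []))"
| "add_step (RElem k r) True = (RElem k r, [True])"
| "add_step (RElem k r) False =
     (if r + 1 < arity \<delta> k then (RElem k (r + 1), False # replicate m True) else (RIdx 0, [False]))"
| "add_step s b = (Dead, [])"

definition add_fin :: "rstate \<Rightarrow> bool list" where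
  "add_fin s = (if s = RIdx 0 then [] else [True])"

abbreviation add_out :: "rstate \<Rightarrow> bool list \<Rightarrow> bool list" where
  "add_out \<equiv> transduce add_step add_fin"

definition add_word :: "bool list \<Rightarrow> bool list" where
  "add_word = add_out Start"

definition shift_tuples :: "('i \<times> nat list) list \<Rightarrow> ('i \<times> nat list) list" where
  "shift_tuples = map (\<lambda>(i, t). (i, map ((+) m) t))"

lemma add_out_Dead: "add_out Dead w = [True]"
  by (induction w) (simp_all add: add_fin_def)

lemma add_out_Size: "add_out Size (unary n @ w) =
    unary n @ concat (map encode_tuple E) @ add_out (RIdx 0) w"
  by (induction n) (simp_all add: unary_simps)

lemma add_out_RIdx: "k + j \<in> indices I \<Longrightarrow>
  add_out (RIdx k) (unary j @ w) = unary j @ replicate m True @ add_out (RElem (k + j) 0) w"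
proof (induction j arbitrary: k)
  case (Suc j)
  have "\<exists>j'\<in>indices I. k < j'" using Suc.prems by (intro bexI[of _ "k + Suc j"]) auto
  then show ?case using Suc by (simp add: unary_simps)
qed (simp add: unary_simps)

lemma add_out_RElem: "add_out (RElem k r) (unary d @ w) = unary d @
    (if r + 1 < arity \<delta> k then replicate m True @ add_out (RElem k (r + 1)) w else add_out (RIdx 0) w)"
  by (induction d) (simp_all add: unary_simps)

lemma add_out_tuple:
  assumes "t \<noteq> []" "r + length t = arity \<delta> k"
  shows "replicate m True @ add_out (RElem k r) (concat (map unary t) @ w) =
    concat (map unary (map ((+) m) t)) @ add_out (RIdx 0) w"
  using assms
proof (induction t arbitrary: r)
  case (Cons d t)
  have "replicate m True @ unary d @ v = unary (m + d) @ v" for v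
    using unary_add[of m d] by (metis append_assoc)
  then show ?case using Cons by (cases t) (simp_all add: add_out_RElem)
qed simp

lemma add_out_tuples:
  assumes "is_type I \<delta>" "well_typed I \<delta> ts"
  shows "add_out (RIdx 0) (concat (map encode_tuple ts)) = concat (map encode_tuple (shift_tuples ts))"
  using assms(2)
proof (induction ts)
  case Nil
  show ?case by (simp add: shift_tuples_def add_fin_def)
next
  case (Cons x ts)
  obtain i t where x: "x = (i, t)" by (cases x)
  have it: "i \<in> I" "length t = \<delta> i" "well_typed I \<delta> ts"
    using Cons.prems by (simp_all add: x well_typed_def)
  then have "t \<noteq> []" using assms(1) unfolding is_type_def by fastforce
  then show ?case using Cons.IH[OF it(3)] it
    by (simp add: x shift_tuples_def add_out_RIdx add_out_tuple)
qed

fun forget :: "pstate \<Rightarrow> rstate" where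
  "forget (Idx k) = RIdx k"
| "forget (Elem k vs) = RElem k (length vs)"

text \<open>The transducer forgets the values and hence runs in parallel with the automaton. Once that fails, it
  stays in \<open>Dead\<close> and ends its output with True; the same output marks a word that breaks off inside a tuple.\<close>

lemma add_out_ill_formed:
  "\<not> reads I \<delta> lk ok s e w \<Longrightarrow> lk = (\<lambda>_. Some 0) \<Longrightarrow> ok = (\<lambda>_ _. True) \<Longrightarrow>
   \<exists>u. add_out (forget s) w = u @ [True]"
proof (induction lk ok s e w rule: reads.induct[where \<delta> = \<delta>])
  case (1 lk ok s e)
  then show ?case by (cases s) (auto simp: add_fin_def)
qed (auto simp: add_out_Dead split: if_splits)

text \<open>The tuples \<open>E\<close> come first, as they are written at the end of the block for \<open>n\<close>, before the
  tuples of the input are read.\<close>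

lemma add_word_encode:
  assumes "is_type I \<delta>" "well_typed I \<delta> ts" "0 < n"
  shows "add_word (encode n ts) = encode (m + n) (E @ shift_tuples ts)"
proof -
  obtain n' where n: "n = Suc n'" using assms(3) gr0_implies_Suc by blast
  have "replicate m True @ unary n' @ v = unary (m + n') @ v" for v
    using unary_add[of m n'] by (metis append_assoc)
  then show ?thesis using add_out_tuples[OF assms(1,2)]
    by (simp add: add_word_def encode_def n unary_simps add_out_Size)
qed

lemma add_word_cases:
  assumes "is_type I \<delta>"
  obtains (code) n ts where "w = encode n ts" "well_typed I \<delta> ts" "0 < n"
  | (bad) u where "add_word w = u @ [True]"
proof (cases "w = [] \<or> \<not> hd w")
  case True
  then have "\<exists>u. add_word w = u @ [True]"
    by (cases w) (auto simp: add_word_def add_fin_def add_out_Dead)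
  then show ?thesis using bad by blast
next
  case False
  then obtain w' where w: "w = True # w'" by (cases w) auto
  show ?thesis
  proof (cases "False \<in> set w'")
    case True
    then obtain n v where w': "w' = unary n @ v" using unary_prefix by blast
    show ?thesis
    proof (cases "reads I \<delta> (\<lambda>_. Some 0) (\<lambda>_ _. True) (Idx 0) 0 v")
      case True
      then obtain ts where "v = concat (map encode_tuple ts)" "well_typed I \<delta> ts"
        using reads_iff[OF assms] by blast
      then show ?thesis using code[of "Suc n" ts] by (simp add: w w' encode_def unary_simps)
    next
      case False
      then obtain u where "add_out (RIdx 0) v = u @ [True]" using add_out_ill_formed by fastforce
      then show ?thesis using bad by (simp add: w w' add_word_def add_out_Size)
    qed
  next
    case False
    then have "\<exists>u. add_out Size w' = u @ [True]"
      by (induction w') (auto simp: add_fin_def)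
    then show ?thesis using bad by (auto simp: w add_word_def)
  qed
qed

lemma add_word_poly_time:
  assumes "is_type I \<delta>" "poly_time_computable f"
  shows "poly_time_computable (\<lambda>x. add_word (f x))"
proof -
  define \<tau> where "\<tau> = (\<lambda>s b. (fst (add_step s b), map bit_symbol (snd (add_step s b))))"
  define fin where "fin = (\<lambda>s. map bit_symbol (add_fin s))"
  have out: "transduce \<tau> fin s w = map bit_symbol (add_out s w)" for s w
    by (induction w arbitrary: s) (simp_all add: \<tau>_def fin_def)
  define Q where "Q = {Start, Size, Dead} \<union> RIdx ` (\<Union>j\<in>insert 0 (indices I). {..j}) \<union>
    (\<lambda>(k, r). RElem k r) ` (SIGMA k:indices I. {..<arity \<delta> k})"
  define B where "B = m + length (concat (map encode_tuple E)) + 1"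
  have fin_ind: "finite (indices I)" using assms(1) by (simp add: is_type_def indices_def)
  have pos: "0 < arity \<delta> k" if "k \<in> indices I" for k
    using that assms(1) by (fastforce simp: indices_def arity_def is_type_def)
  have mem: "Start \<in> Q" "Size \<in> Q" "Dead \<in> Q" "RIdx 0 \<in> Q"
    "RIdx k \<in> Q \<longleftrightarrow> k = 0 \<or> (\<exists>j\<in>indices I. k \<le> j)"
    "RElem k r \<in> Q \<longleftrightarrow> k \<in> indices I \<and> r < arity \<delta> k" for k r
    by (auto simp: Q_def)
  have closed: "fst (add_step s b) \<in> Q" if "s \<in> Q" for s b
  proof (cases "(s, b)" rule: add_step.cases)
    case (4 k)
    then show ?thesis using mem by (auto simp: Suc_le_eq)
  next
    case (5 k)
    then show ?thesis using mem pos by auto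
  next
    case (7 k r)
    then show ?thesis using mem that by auto
  qed (use mem that in auto)
  have len: "length (snd (add_step s b)) \<le> B" for s b
    by (cases "(s, b)" rule: add_step.cases) (auto simp: B_def)
  have bits: "set (map bit_symbol u) \<subseteq> {1..<3}" for u
    using bit_symbol_range by (auto simp: less_Suc_eq_le numeral_3_eq_3 numeral_2_eq_2)
  have "is_transducer Q \<tau> fin 3 B"
    unfolding is_transducer_def
  proof (intro conjI ballI allI)
    show "finite Q" using fin_ind by (simp add: Q_def)
  qed (use closed len bits in \<open>auto simp: \<tau>_def fin_def add_fin_def B_def simp del: set_map\<close>)
  then show ?thesis
    using poly_time_transduce[OF assms(2) _ mem(1), of \<tau> fin B add_word] out
    by (simp add: add_word_def)
qed

end

lemma encode_in_GCSP_iff: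
  fixes I :: "'i::countable set"
  assumes "well_typed I \<delta> ts"
  shows "encode n ts \<in> GCSP I \<delta> \<H> \<longleftrightarrow> below n ts \<and> (\<exists>H\<in>\<H>. \<exists>h. maps_into n ts H h)"
proof
  assume "encode n ts \<in> GCSP I \<delta> \<H>"
  then obtain n' us H h where us: "encode n ts = encode n' us" "well_typed I \<delta> us"
    "below n' us" "H \<in> \<H>" "maps_into n' us H h"
    unfolding GCSP_iff by blast
  then have "n = n' \<and> ts = us" using encode_inj assms by blast
  then show "below n ts \<and> (\<exists>H\<in>\<H>. \<exists>h. maps_into n ts H h)" using us by blast
qed (use assms in \<open>unfold GCSP_iff, blast\<close>)

text \<open>An ill-typed word is dealt with by its last letter. If only the elements of a well-typed code exceed the
  base set, then so do the shifted ones, and neither word is a code of a structure.\<close>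

lemma add_word_reduces:
  assumes type: "is_type I \<delta>" and H: "H \<in> \<H>" "is_structure I \<delta> H"
    and inc: "pairwise (incomparable I) \<H>"
    and g: "bij_betw g (base H) {..<m}"
    and E: "set E = {(i, map g t) | i t. i \<in> I \<and> t \<in> rel H i}"
  shows "w \<in> CSP I \<delta> H \<longleftrightarrow> add_word I \<delta> m E w \<in> GCSP I \<delta> \<H>"
proof -
  have rel: "length t = \<delta> i \<and> set t \<subseteq> base H" if "i \<in> I" "t \<in> rel H i" for i t
    using that H(2) unfolding is_structure_def by blast
  have g_less: "g x < m" if "x \<in> base H" for x using g that by (auto simp: bij_betw_def)
  have wt: "well_typed I \<delta> (E @ shift_tuples m ts)" if "well_typed I \<delta> ts" for ts
    using that rel by (fastforce simp: well_typed_def E shift_tuples_def)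
  have inj: "inj_on g (base H)" using g by (simp add: bij_betw_def)
  consider (code) n ts where "w = encode n ts" "well_typed I \<delta> ts" "0 < n"
    | (bad) u where "add_word I \<delta> m E w = u @ [True]"
    by (rule add_word_cases[OF type])
  then show ?thesis
  proof cases
    case (code n ts)
    note f = add_word_encode[OF type code(2,3), of m E]
    have "w \<in> CSP I \<delta> H \<longleftrightarrow> below n ts \<and> (\<exists>h. maps_into n ts H h)"
      by (simp add: CSP_eq_GCSP code(1) encode_in_GCSP_iff[OF code(2)])
    also have "\<dots> \<longleftrightarrow> below (m + n) (E @ shift_tuples m ts) \<and>
        (\<exists>H'\<in>\<H>. \<exists>h. maps_into (m + n) (E @ shift_tuples m ts) H' h)" (is "?L \<longleftrightarrow> ?R")
    proof
      assume ?L
      then obtain h where b: "below n ts" and h: "maps_into n ts H h" by blast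
      define h' where "h' x = (if x < m then inv_into (base H) g x else h (x - m))" for x
      have "h' ` {..<m + n} \<subseteq> base H"
      proof clarify
        fix x assume x: "x < m + n"
        show "h' x \<in> base H"
        proof (cases "x < m")
          case True
          then have "x \<in> g ` base H" using g by (auto simp: bij_betw_def)
          then show ?thesis using True by (simp add: h'_def inv_into_into)
        next
          case False
          then show ?thesis using x h by (auto simp: h'_def maps_into_def)
        qed
      qed
      moreover have "map h' (map g t) = t" if "set t \<subseteq> base H" for t
        using that inj g_less by (auto simp: h'_def intro!: map_idI)
      moreover have "map h' (map ((+) m) t) = map h t" for t
        by (simp add: h'_def)
      ultimately have "maps_into (m + n) (E @ shift_tuples m ts) H h'"
        using h rel unfolding maps_into_def by (auto simp: E shift_tuples_def simp del: map_map)
      moreover have "below (m + n) (E @ shift_tuples m ts)"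
        using b g_less rel unfolding below_def by (fastforce simp: E shift_tuples_def)
      ultimately show ?R using H(1) by blast
    next
      assume ?R
      then obtain H' h where H': "H' \<in> \<H>" and h: "maps_into (m + n) (E @ shift_tuples m ts) H' h"
        and b: "below (m + n) (E @ shift_tuples m ts)"
        by blast
      have "h (g x) \<in> base H'" if "x \<in> base H" for x
        using h g_less[OF that] unfolding maps_into_def by auto
      moreover have "map h (map g t) \<in> rel H' i" if "i \<in> I" "t \<in> rel H i" for i t
        using h that unfolding maps_into_def by (fastforce simp: E simp del: map_map)
      ultimately have "is_hom I H H' (h \<circ> g)" unfolding is_hom_def by auto
      then have "hom_to I H H'" unfolding hom_to_def by blast
      then have "H' = H" using inc H(1) H' unfolding pairwise_def incomparable_def by blast
      moreover have "map (\<lambda>x. h (m + x)) t \<in> rel H' i" if "(i, t) \<in> set ts" for i t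
      proof -
        have "(i, map ((+) m) t) \<in> set (E @ shift_tuples m ts)"
          using that by (force simp: shift_tuples_def)
        then have "map h (map ((+) m) t) \<in> rel H' i" using h unfolding maps_into_def by blast
        then show ?thesis by (simp add: comp_def)
      qed
      ultimately have "maps_into n ts H (\<lambda>x. h (m + x))"
        using h unfolding maps_into_def by (fastforce simp: image_subset_iff)
      moreover have "set t \<subseteq> {..<n}" if "(i, t) \<in> set ts" for i t
      proof -
        have "(i, map ((+) m) t) \<in> set (E @ shift_tuples m ts)"
          using that by (force simp: shift_tuples_def)
        then have "set (map ((+) m) t) \<subseteq> {..<m + n}" using b unfolding below_def by blast
        then show ?thesis by auto
      qed
      ultimately show ?L using code(3) unfolding below_def by blast
    qed
    also have "\<dots> \<longleftrightarrow> add_word I \<delta> m E w \<in> GCSP I \<delta> \<H>"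
      by (simp add: code(1) f encode_in_GCSP_iff[OF wt[OF code(2)]])
    finally show ?thesis .
  next
    case (bad u)
    have "add_word I \<delta> m E w \<notin> GCSP I \<delta> \<H>"
    proof
      assume "add_word I \<delta> m E w \<in> GCSP I \<delta> \<H>"
      then obtain n ts where "add_word I \<delta> m E w = encode n (ts :: ('a \<times> nat list) list)"
        unfolding GCSP_iff by blast
      then show False using bad encode_ends_False[of n ts] by auto
    qed
    moreover have "w \<notin> CSP I \<delta> H"
    proof
      assume "w \<in> CSP I \<delta> H"
      then obtain n ts where "w = encode n ts" "well_typed I \<delta> ts" "0 < n"
        unfolding CSP_eq_GCSP GCSP_iff below_def by auto
      then have "u @ [True] = encode (m + n) (E @ shift_tuples m ts)"
        using add_word_encode[OF type, of ts n m E] bad by simp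
      then show False using encode_ends_False[of "m + n" "E @ shift_tuples m ts"] by auto
    qed
    ultimately show ?thesis by simp
  qed
qed

lemma CSP_reduces_to_GCSP:
  assumes type: "is_type I \<delta>" and H: "H \<in> \<H>" "is_structure I \<delta> H"
    and inc: "pairwise (incomparable I) \<H>" and L: "poly_reducible L (CSP I \<delta> H)"
  shows "poly_reducible L (GCSP I \<delta> \<H>)"
proof -
  have fin: "finite (base H)" using H(2) by (simp add: is_structure_def)
  obtain g where "bij_betw g (base H) {0..<card (base H)}" using ex_bij_betw_finite_nat[OF fin] by blast
  then have g: "bij_betw g (base H) {..<card (base H)}" by (simp add: atLeast0LessThan)
  have "finite (rel H i)" if "i \<in> I" for i
    by (rule finite_subset[OF _ finite_lists_length_eq[OF fin, of "\<delta> i"]])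
      (use H(2) that in \<open>auto simp: is_structure_def\<close>)
  then have "finite (\<Union>i\<in>I. (\<lambda>t. (i, map g t)) ` rel H i)" using type by (simp add: is_type_def)
  moreover have "(\<Union>i\<in>I. (\<lambda>t. (i, map g t)) ` rel H i) = {(i, map g t) | i t. i \<in> I \<and> t \<in> rel H i}"
    by auto
  ultimately have "finite {(i, map g t) | i t. i \<in> I \<and> t \<in> rel H i}" by simp
  from finite_list[OF this] obtain E where E: "set E = {(i, map g t) | i t. i \<in> I \<and> t \<in> rel H i}"
    by (rule exE)
  obtain f where f: "poly_time_computable f" "\<And>x. x \<in> L \<longleftrightarrow> f x \<in> CSP I \<delta> H"
    using L unfolding poly_reducible_def by blast
  show ?thesis
    unfolding poly_reducible_def
    using add_word_poly_time[OF type f(1), of "card (base H)" E]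
      f(2) add_word_reduces[OF type H inc g E]
    by (intro exI[of _ "\<lambda>x. add_word I \<delta> (card (base H)) E (f x)"]) simp
qed

section \<open>Verifying a homomorphism\<close>

text \<open>The verifier has the input on its first tape and on its last tape a table, whose cell \<open>x\<close> holds the
  value of the element \<open>x\<close>. Values of different target structures must not be mixed; for this the states remember
  the first value \<open>v\<close> of the table, with which all others are compared by \<open>same\<close> while the number of
  table entries is compared with the size of the input structure. In \<open>Reset v s\<close> the second head returns to the start
  of the table before parsing continues from \<open>s\<close>.\<close>

datatype vstate = Begin | Prefix nat | Parse nat pstate | Reset nat pstate | Yes | No

instance pstate :: countable by countable_datatype
instance vstate :: countable by countable_datatype

definition lookup :: "nat list \<Rightarrow> nat \<Rightarrow> nat option" where
  "lookup tab x = (if x < length tab then Some (tab ! x) else None)"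

context
  fixes I :: "'i::countable set" and \<delta> :: "'i \<Rightarrow> nat" and m :: nat
    and same :: "nat \<Rightarrow> nat \<Rightarrow> bool" and ok :: "nat \<Rightarrow> nat \<Rightarrow> nat list \<Rightarrow> bool"
begin

fun vstep :: "vstate \<Rightarrow> nat \<Rightarrow> nat \<Rightarrow> vstate \<times> (nat \<times> move) \<times> (nat \<times> move)" where
  "vstep Begin a b = (if b = 0 then No else Prefix b, stay a, stay b)"
| "vstep (Prefix v) a b =
    (if a = 2 \<and> b \<noteq> 0 \<and> same v b then (Prefix v, (a, Move_Right), (b, Move_Right))
     else if a = 1 \<and> b = 0 then (Reset v (Idx 0), (a, Move_Right), (b, Move_Left))
     else (No, stay a, stay b))"
| "vstep (Reset v s) a b =
    (if b = 0 then (Parse v s, stay a, (b, Move_Right)) else (Reset v s, stay a, (b, Move_Left)))"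
| "vstep (Parse v (Idx k)) a b =
    (if a = 0 then (if k = 0 then Yes else No, stay a, stay b)
     else if a = 2 then
       (if \<exists>j\<in>indices I. k < j then Parse v (Idx (Suc k)) else No, (a, Move_Right), stay b)
     else (if k \<in> indices I then Parse v (Elem k []) else No, (a, Move_Right), stay b))"
| "vstep (Parse v (Elem k vs)) a b =
    (if a = 2 then (Parse v (Elem k vs), (a, Move_Right), (b, Move_Right))
     else if a = 0 \<or> b = 0 then (No, stay a, stay b)
     else (if length vs + 1 < arity \<delta> k then Reset v (Elem k (vs @ [b]))
           else if ok v k (vs @ [b]) then Reset v (Idx 0) else No,
           (a, Move_Right), (b, Move_Left)))"
| "vstep s a b = (s, stay a, stay b)"

definition pstates :: "pstate set" where
  "pstates = Idx ` (\<Union>j\<in>insert 0 (indices I). {..j}) \<union>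
     (\<lambda>(k, vs). Elem k vs) ` (SIGMA k:indices I. {vs. set vs \<subseteq> {..<m} \<and> length vs \<le> arity \<delta> k})"

definition vstates :: "vstate set" where
  "vstates = {Begin, Yes, No} \<union> Prefix ` {..<m} \<union>
     case_prod Parse ` ({..<m} \<times> pstates) \<union> case_prod Reset ` ({..<m} \<times> pstates)"

definition verifier :: tm where
  "verifier = two_head 3 m vstates Begin Yes No vstep"

lemma verifier_simps [simp]: "tapes verifier = 3" "symbols verifier = m"
  "start verifier = to_nat Begin" "exit_state verifier b = to_nat (if b then Yes else No)"
  by (simp_all add: verifier_def)

lemma wf_verifier:
  assumes "is_type I \<delta>" "3 \<le> m"
  shows "wf_tm verifier"
  unfolding verifier_def
proof (rule wf_two_head)
  have "finite {vs. set vs \<subseteq> {..<m} \<and> length vs \<le> n}" for n by (rule finite_lists_length_le) simp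
  then have "finite pstates" using assms(1) by (auto simp: pstates_def indices_def is_type_def)
  then show "finite vstates" unfolding vstates_def by auto
  have p: "Idx k \<in> pstates \<longleftrightarrow> k = 0 \<or> (\<exists>j\<in>indices I. k \<le> j)"
    "Elem k vs \<in> pstates \<longleftrightarrow> k \<in> indices I \<and> set vs \<subseteq> {..<m} \<and> length vs \<le> arity \<delta> k" for k vs
    by (auto simp: pstates_def)
  have v: "Begin \<in> vstates" "Yes \<in> vstates" "No \<in> vstates" "Prefix u \<in> vstates \<longleftrightarrow> u < m"
    "Parse u s \<in> vstates \<longleftrightarrow> u < m \<and> s \<in> pstates" "Reset u s \<in> vstates \<longleftrightarrow> u < m \<and> s \<in> pstates" for u s
    by (auto simp: vstates_def)
  show "Begin \<in> vstates" "Yes \<in> vstates" "No \<in> vstates" using v by auto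
  fix s a b s' x y
  assume s: "s \<in> vstates" and ab: "a < m" "b < m" and f: "vstep s a b = (s', x, y)"
  show "s' \<in> vstates \<and> fst x < m \<and> fst y < m"
  proof (cases "(s, a, b)" rule: vstep.cases)
    case (4 u k a' b')
    then show ?thesis using s ab f v p by (auto simp: Suc_le_eq split: if_splits)
  next
    case (5 u k vs a' b')
    then show ?thesis using s ab f v p by (auto split: if_splits)
  qed (use s ab f v p in \<open>auto split: if_splits\<close>)
qed (use assms(2) in auto)

lemma verifier_step:
  assumes "s \<noteq> Yes" "s \<noteq> No"
  shows "step verifier (to_nat s, (c, p) # mid @ [(d, r)]) =
    (case vstep s (c p) (d r) of (s', (z, e), (z', e')) \<Rightarrow>
      (to_nat s', (c(p := z), shift e p) # mid @ [(d(r := z'), shift e' r)]))"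
  unfolding verifier_def using assms step_two_head by (auto split: prod.splits)

definition verifies :: "nat list \<Rightarrow> nat \<Rightarrow> nat \<Rightarrow> bool list \<Rightarrow> bool" where
  "verifies tab v e w \<longleftrightarrow> (\<forall>x\<in>set (drop e tab). same v x) \<and>
     (\<exists>rest. w = unary (length tab - e) @ rest \<and> reads I \<delta> (lookup tab) (ok v) (Idx 0) 0 rest)"

context
  fixes tab :: "nat list" and mid :: "tape list"
  assumes tab: "0 \<notin> set tab"
begin

lemma tab_cell [simp]: "cells tab (int e) = (if e < length tab then tab ! e else 0)"
  by (simp add: cells_def)

lemma tab_nonzero: "e < length tab \<Longrightarrow> 0 < tab ! e"
  using tab by (metis gr0I nth_mem)

lemma verifier_reset:
  assumes "n \<le> length tab"
  shows "reach verifier (n + 1) (to_nat (Reset v s), (c, p) # mid @ [(cells tab, int n - 1)])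
     (to_nat (Parse v s), (c, p) # mid @ [(cells tab, 0)])"
  using assms
proof (induction n)
  case 0
  show ?case by (rule reach_one) (simp_all add: verifier_step fun_upd_idem)
next
  case (Suc n)
  have "step verifier (to_nat (Reset v s), (c, p) # mid @ [(cells tab, int n)]) =
    (to_nat (Reset v s), (c, p) # mid @ [(cells tab, int n - 1)])"
    using Suc.prems tab_nonzero[of n] by (simp add: verifier_step fun_upd_idem)
  from reach_step[OF this Suc.IH, of "Suc n + 1"] Suc.prems show ?case by simp
qed

text \<open>Looking up the element \<open>e\<close> costs \<open>e + 1\<close> steps for the way back. These are charged to the \<open>e\<close> letters
  of its unary block, which is why \<open>e\<close> occurs in the time bound and the total is linear. The head may leave
  the table to the right; the blank read at the end of the block then leads to rejection.\<close>

lemma verifier_parse: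
  assumes "\<And>k. s = Idx k \<Longrightarrow> e = 0"
  shows "\<exists>ts. reach verifier (3 * length w + e + 2)
     (to_nat (Parse v s), (cells (map bit_symbol (u @ w)), int (length u)) # mid @ [(cells tab, int e)])
     (exit_state verifier (reads I \<delta> (lookup tab) (ok v) s e w), ts)"
  using assms
proof (induction w arbitrary: u s e)
  case Nil
  have c: "cells (map bit_symbol u) (int (length u)) = 0"
    using cells_end(1)[of "map bit_symbol u"] by simp
  show ?case
  proof (cases s)
    case (Idx k)
    then show ?thesis
      by (intro exI reach_one) (auto simp: verifier_step c)
  next
    case (Elem k vs)
    then show ?thesis
      by (intro exI reach_one) (auto simp: verifier_step c)
  qed
next
  case (Cons b w)
  let ?c = "cells (map bit_symbol u @ bit_symbol b # map bit_symbol w)"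
  have c: "?c (int (length u)) = bit_symbol b"
    using cells_append_nth[of "map bit_symbol u" "bit_symbol b" "map bit_symbol w"] by simp
  have IH: "\<exists>ts. reach verifier (3 * length w + e + 2)
     (to_nat (Parse v s), (?c, int (length u) + 1) # mid @ [(cells tab, int e)])
     (exit_state verifier (reads I \<delta> (lookup tab) (ok v) s e w), ts)"
    if "\<And>k. s = Idx k \<Longrightarrow> e = 0" for s e
    using Cons.IH[of s e "u @ [b]"] that by (simp add: add.commute)
  have go: ?case
    if st: "step verifier (to_nat (Parse v s), (?c, int (length u)) # mid @ [(cells tab, int e)]) =
        (to_nat (Parse v s'), (?c, int (length u) + 1) # mid @ [(cells tab, int e')])"
      and eq: "reads I \<delta> (lookup tab) (ok v) s e (b # w) = reads I \<delta> (lookup tab) (ok v) s' e' w"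
      and e': "e' \<le> e + 1" "\<And>k. s' = Idx k \<Longrightarrow> e' = 0" for s' e'
  proof -
    obtain ts where ts: "reach verifier (3 * length w + e' + 2)
       (to_nat (Parse v s'), (?c, int (length u) + 1) # mid @ [(cells tab, int e')])
       (exit_state verifier (reads I \<delta> (lookup tab) (ok v) s e (b # w)), ts)"
      using IH[of s' e'] e'(2) unfolding eq by blast
    show ?thesis using reach_step[OF st ts, of "3 * length (b # w) + e + 2"] e'(1) by auto
  qed
  have no: ?case
    if "step verifier (to_nat (Parse v s), (?c, int (length u)) # mid @ [(cells tab, int e)]) =
        (to_nat No, ts)" and "\<not> reads I \<delta> (lookup tab) (ok v) s e (b # w)" for ts
    using reach_one[OF that(1), of "3 * length (b # w) + e + 2"] that(2) by auto
  show ?case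
  proof (cases s)
    case (Idx k)
    then have e: "e = 0" using Cons.prems by blast
    show ?thesis
    proof (cases b)
      case True
      show ?thesis
      proof (cases "\<exists>j\<in>indices I. k < j")
        case T: True
        show ?thesis
          by (rule go[of "Idx (Suc k)" 0]) (use Idx True T e c in \<open>simp_all add: verifier_step fun_upd_idem\<close>)
      next
        case F: False
        show ?thesis
          by (rule no) (use Idx True F e c in \<open>simp_all add: verifier_step fun_upd_idem\<close>)
      qed
    next
      case False
      show ?thesis
      proof (cases "k \<in> indices I")
        case T: True
        show ?thesis
          by (rule go[of "Elem k []" 0]) (use Idx False T e c in \<open>simp_all add: verifier_step fun_upd_idem\<close>)
      next
        case F: False
        show ?thesis
          by (rule no) (use Idx False F e c in \<open>simp_all add: verifier_step fun_upd_idem\<close>)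
      qed
    qed
  next
    case (Elem k vs)
    show ?thesis
    proof (cases b)
      case True
      show ?thesis
        by (rule go[of "Elem k vs" "Suc e"])
          (use Elem True c in \<open>simp_all add: verifier_step fun_upd_idem add.commute\<close>)
    next
      case False
      show ?thesis
      proof (cases "e < length tab")
        case F: False
        show ?thesis
          by (rule no) (use Elem False F c in \<open>simp_all add: verifier_step fun_upd_idem lookup_def\<close>)
      next
        case T: True
        note nz = tab_nonzero[OF T]
        define s' where "s' = (if length vs + 1 < arity \<delta> k then Elem k (vs @ [tab ! e]) else Idx 0)"
        show ?thesis
        proof (cases "length vs + 1 < arity \<delta> k \<or> ok v k (vs @ [tab ! e])")
          case True
          then have eq: "reads I \<delta> (lookup tab) (ok v) s e (b # w) = reads I \<delta> (lookup tab) (ok v) s' 0 w"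
            using Elem False T by (auto simp: lookup_def s'_def)
          have st: "step verifier (to_nat (Parse v s), (?c, int (length u)) # mid @ [(cells tab, int e)]) =
              (to_nat (Reset v s'), (?c, int (length u) + 1) # mid @ [(cells tab, int e - 1)])"
            using True Elem False T nz c by (auto simp: verifier_step fun_upd_idem s'_def)
          obtain ts where ts: "reach verifier (3 * length w + 2)
              (to_nat (Parse v s'), (?c, int (length u) + 1) # mid @ [(cells tab, 0)])
              (exit_state verifier (reads I \<delta> (lookup tab) (ok v) s e (b # w)), ts)"
            using IH[of s' 0] unfolding eq by auto
          have "reach verifier (e + 1 + (3 * length w + 2))
              (to_nat (Reset v s'), (?c, int (length u) + 1) # mid @ [(cells tab, int e - 1)])
              (exit_state verifier (reads I \<delta> (lookup tab) (ok v) s e (b # w)), ts)"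
            by (rule reach_trans[OF verifier_reset ts]) (use T in auto)
          from reach_step[OF st this, of "3 * length (b # w) + e + 2"] show ?thesis by auto
        next
          case F: False
          show ?thesis
            by (rule no) (use Elem False F T nz c in \<open>simp_all add: verifier_step fun_upd_idem lookup_def\<close>)
        qed
      qed
    qed
  qed
qed

lemma verifier_prefix:
  assumes "e \<le> length tab"
  shows "\<exists>ts. reach verifier (4 * length w + e + 5)
     (to_nat (Prefix v), (cells (map bit_symbol (u @ w)), int (length u)) # mid @ [(cells tab, int e)])
     (exit_state verifier (verifies tab v e w), ts)"
  using assms
proof (induction w arbitrary: u e)
  case Nil
  have c: "cells (map bit_symbol u) (int (length u)) = 0"
    using cells_end(1)[of "map bit_symbol u"] by simp
  have "\<not> verifies tab v e []" by (simp add: verifies_def unary_def)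
  then show ?case by (intro exI reach_one) (auto simp: verifier_step c)
next
  case (Cons b w)
  let ?c = "cells (map bit_symbol u @ bit_symbol b # map bit_symbol w)"
  have c: "?c (int (length u)) = bit_symbol b"
    using cells_append_nth[of "map bit_symbol u" "bit_symbol b" "map bit_symbol w"] by simp
  have no: ?case
    if "step verifier (to_nat (Prefix v), (?c, int (length u)) # mid @ [(cells tab, int e)]) =
        (to_nat No, ts)" and "\<not> verifies tab v e (b # w)" for ts
    using reach_one[OF that(1), of "4 * length (b # w) + e + 5"] that(2) by auto
  show ?case
  proof (cases "e = length tab")
    case e: True
    show ?thesis
    proof (cases b)
      case True
      show ?thesis
        by (rule no) (use True e c in \<open>simp_all add: verifier_step fun_upd_idem verifies_def unary_simps\<close>)
    next
      case False
      have eq: "verifies tab v e (b # w) = reads I \<delta> (lookup tab) (ok v) (Idx 0) 0 w"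
        using False e by (simp add: verifies_def unary_simps)
      have st: "step verifier (to_nat (Prefix v), (?c, int (length u)) # mid @ [(cells tab, int e)]) =
          (to_nat (Reset v (Idx 0)), (?c, int (length u) + 1) # mid @ [(cells tab, int e - 1)])"
        using False e c cells_end(1)[of tab] by (simp add: verifier_step fun_upd_idem del: cells_write cells_end)
      obtain ts where ts: "reach verifier (3 * length w + 0 + 2)
          (to_nat (Parse v (Idx 0)), (?c, int (length u) + 1) # mid @ [(cells tab, 0)])
          (exit_state verifier (verifies tab v e (b # w)), ts)"
        using verifier_parse[of "Idx 0" 0 w v "u @ [b]"] unfolding eq by (auto simp: add.commute)
      have "reach verifier (e + 1 + (3 * length w + 2))
          (to_nat (Reset v (Idx 0)), (?c, int (length u) + 1) # mid @ [(cells tab, int e - 1)])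
          (exit_state verifier (verifies tab v e (b # w)), ts)"
        by (rule reach_trans[OF verifier_reset ts]) (use e in auto)
      from reach_step[OF st this, of "4 * length (b # w) + e + 5"] show ?thesis by auto
    qed
  next
    case False
    then have e: "e < length tab" using Cons.prems by simp
    note nz = tab_nonzero[OF e]
    have d: "drop e tab = tab ! e # drop (Suc e) tab" using Cons_nth_drop_Suc[OF e] by simp
    have len: "length tab - e = Suc (length tab - Suc e)" using e by simp
    show ?thesis
    proof (cases "b \<and> same v (tab ! e)")
      case True
      have eq: "verifies tab v e (b # w) = verifies tab v (Suc e) w"
        using True by (simp add: verifies_def d len unary_simps)
      have st: "step verifier (to_nat (Prefix v), (?c, int (length u)) # mid @ [(cells tab, int e)]) =
          (to_nat (Prefix v), (?c, int (length u) + 1) # mid @ [(cells tab, int (Suc e))])"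
        using True e nz c by (simp add: verifier_step fun_upd_idem add.commute)
      obtain ts where ts: "reach verifier (4 * length w + Suc e + 5)
          (to_nat (Prefix v), (?c, int (length u) + 1) # mid @ [(cells tab, int (Suc e))])
          (exit_state verifier (verifies tab v e (b # w)), ts)"
        using Cons.IH[of "Suc e" "u @ [b]"] e unfolding eq by (auto simp: add.commute)
      from reach_step[OF st ts, of "4 * length (b # w) + e + 5"] show ?thesis by auto
    next
      case F: False
      show ?thesis
        by (rule no) (use F e nz c in \<open>auto simp: verifier_step fun_upd_idem verifies_def d len unary_simps\<close>)
    qed
  qed
qed

lemma verifier_reach:
  "\<exists>ts. reach verifier (4 * length w + 6) (start verifier, word_tape w # mid @ [(cells tab, 0)])
     (exit_state verifier (tab \<noteq> [] \<and> verifies tab (tab ! 0) 0 w), ts)"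
proof (cases "tab = []")
  case True
  then show ?thesis
    by (intro exI reach_one) (auto simp: word_tape_cells verifier_step cells_def)
next
  case False
  then have nz: "0 < tab ! 0" "cells tab 0 = tab ! 0" using tab_nonzero[of 0] tab_cell[of 0] by auto
  have st: "step verifier (start verifier, word_tape w # mid @ [(cells tab, 0)]) =
      (to_nat (Prefix (tab ! 0)), word_tape w # mid @ [(cells tab, 0)])"
    using nz by (simp add: word_tape_cells verifier_step fun_upd_idem)
  obtain ts where "reach verifier (4 * length w + 5)
      (to_nat (Prefix (tab ! 0)), word_tape w # mid @ [(cells tab, 0)])
      (exit_state verifier (verifies tab (tab ! 0) 0 w), ts)"
    using verifier_prefix[of 0 w "tab ! 0" "[]"] by (auto simp: word_tape_cells)
  from reach_step[OF st this, of "4 * length w + 6"] False show ?thesis by auto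
qed

end

end

section \<open>Membership in NP\<close>

lemma class_NP_I:
  fixes p r :: "nat poly"
  assumes M: "wf_tm M" "2 \<le> tapes M"
    and run: "\<And>x y. length y \<le> poly r (length x) \<Longrightarrow>
      \<exists>ts. reach M (poly p (length x)) (init M [x, y]) (exit_state M (A x y), ts)"
    and L: "\<And>x. x \<in> L \<longleftrightarrow> (\<exists>y. length y \<le> poly r (length x) \<and> A x y)"
  shows "L \<in> class_NP"
proof -
  have acc: "accepts_within M [x, y] (poly p (length x)) \<longleftrightarrow> A x y"
    "accepts_within M [x, y] (poly p (length x)) \<or> rejects_within M [x, y] (poly p (length x))"
    if y: "length y \<le> poly r (length x)" for x y
  proof -
    obtain ts where ts: "reach M (poly p (length x)) (init M [x, y]) (exit_state M (A x y), ts)"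
      using run[OF y] by blast
    have "A x y \<longleftrightarrow> True" if "reach M (poly p (length x)) (init M [x, y]) (exit_state M True, us)" for us
      by (rule reach_exit_unique[OF ts that wf_tm_parts(6)[OF M(1)]])
    then show "accepts_within M [x, y] (poly p (length x)) \<longleftrightarrow> A x y"
      unfolding exits_within_iff using ts by (cases "A x y") auto
    show "accepts_within M [x, y] (poly p (length x)) \<or> rejects_within M [x, y] (poly p (length x))"
      unfolding exits_within_iff using ts by (cases "A x y") auto
  qed
  have "x \<in> L \<longleftrightarrow> (\<exists>y. length y \<le> poly r (length x) \<and> accepts_within M [x, y] (poly p (length x)))" for x
    unfolding L using acc(1) by blast
  then show ?thesis unfolding class_NP_def using M acc(2) by blast
qed

text \<open>A unary block of length \<open>k < N\<close> becomes the symbol \<open>k + 1\<close>. Longer blocks are truncated rather than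
  rejected, so that every word is a table over \<open>{1, \<dots>, N}\<close>.\<close>

definition block_step :: "nat \<Rightarrow> nat \<Rightarrow> bool \<Rightarrow> nat \<times> nat list" where
  "block_step N k b = (if b then (min (Suc k) (N - 1), []) else (0, [Suc k]))"

abbreviation blocks :: "nat \<Rightarrow> bool list \<Rightarrow> nat list" where
  "blocks N \<equiv> transduce (block_step N) (\<lambda>_. []) 0"

lemma is_transducer_blocks:
  "0 < N \<Longrightarrow> N < m \<Longrightarrow> is_transducer {..<N} (block_step N) (\<lambda>_. []) m 1"
  by (auto simp: is_transducer_def block_step_def)

lemma blocks_range: "0 < N \<Longrightarrow> set (blocks N y) \<subseteq> {1..N}"
  using transduce_bounds[OF is_transducer_blocks[of N "Suc N"], of 0 y] by auto

lemma blocks_unary: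
  assumes "set tab \<subseteq> {1..N}"
  shows "blocks N (concat (map (\<lambda>s. unary (s - 1)) tab)) = tab"
  using assms
proof (induction tab)
  case (Cons s tab)
  have "transduce (block_step N) (\<lambda>_. []) k (unary d @ w) = Suc (k + d) # blocks N w"
    if "k + d < N" for k d w
    using that
  proof (induction d arbitrary: k)
    case (Suc d)
    then have "min (Suc k) (N - 1) = Suc k" by simp
    then show ?case using Suc.IH[of "Suc k"] Suc.prems by (simp add: unary_simps block_step_def)
  qed (simp add: unary_simps block_step_def)
  from this[of 0 "s - 1"] Cons show ?case by auto
qed simp

text \<open>Values are numbers of pairs of a structure \<open>H\<close> in \<open>\<H>\<close> and one of its elements, so a single
  table names both the structure and the homomorphism. Since all entries agree in \<open>H\<close>, the one for the
  element \<open>0\<close> tells which relations to look at.\<close>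

lemma GCSP_in_NP:
  fixes I :: "'i::countable set" and \<H> :: "('a, 'i) rstruct set"
  assumes type: "is_type I \<delta>" and \<H>: "finite \<H>" "\<H> \<noteq> {}" "\<forall>H\<in>\<H>. is_structure I \<delta> H"
  shows "GCSP I \<delta> \<H> \<in> class_NP"
proof -
  define S where "S = Sigma \<H> base"
  have "finite S" "S \<noteq> {}"
    using \<H> by (auto simp: S_def is_structure_def Sigma_empty_iff)
  define N where "N = card S"
  have N: "0 < N" using \<open>finite S\<close> \<open>S \<noteq> {}\<close> by (simp add: N_def card_gt_0_iff)
  obtain g where g: "bij_betw g {1..N} S"
    using ex_bij_betw_nat_finite_1[OF \<open>finite S\<close>] unfolding N_def by blast
  define same where "same = (\<lambda>v u. fst (g v) = fst (g u))"
  define ok where "ok = (\<lambda>v k vs. map (\<lambda>u. snd (g u)) vs \<in> rel (fst (g v)) (from_nat k))"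
  define m where "m = N + 3"
  define V C D M where "V = verifier I \<delta> m same ok"
    and "C = transducer 2 m {..<N} (block_step N) (\<lambda>_. []) 1 0"
    and "D = on_tapes 1 3 m C" and "M = branch True D V"
  have tr: "is_transducer {..<N} (block_step N) (\<lambda>_. []) m 1"
    using is_transducer_blocks N by (simp add: m_def)
  have wfC: "wf_tm C" unfolding C_def by (rule wf_transducer[OF tr]) (use N in \<open>auto simp: m_def\<close>)
  have wfD: "wf_tm D" unfolding D_def by (rule wf_on_tapes[OF wfC]) (simp_all add: C_def)
  have wfV: "wf_tm V" unfolding V_def by (rule wf_verifier[OF type]) (simp add: m_def)
  have wfM: "wf_tm M" unfolding M_def
    by (rule wf_branch[OF wfD wfV]) (simp_all add: D_def V_def)
  have tapesM: "tapes M = 3" by (simp add: M_def D_def)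

  define A where "A = (\<lambda>x y. blocks N y \<noteq> [] \<and>
    verifies I \<delta> same ok (blocks N y) (blocks N y ! 0) 0 x)"
  define r where "r = [:0, N:]"
  define p where "p = [:7:] * ([:0, N:] + [:1:]) + [:7, 4:]"

  have run: "\<exists>ts. reach M (poly p (length x)) (init M [x, y]) (exit_state M (A x y), ts)"
    if y: "length y \<le> poly r (length x)" for x y
  proof -
    have iM: "init M [x, y] = (start M, [word_tape x] @ [word_tape y, word_tape []] @ [])"
      by (simp add: init_def tapesM)
    have lC: "legal C (start C, [word_tape y, word_tape []])"
      using legal_words[OF wfC, of "[y, []]"] by (simp add: C_def)
    have "reach C (7 * (length y + 1)) (start C, [word_tape y, word_tape []])
        (exit_state C True, [word_tape y, (cells (blocks N y), 0)])"
      using transducer_reach[OF tr, of 0 y "7 * (length y + 1)" 2 "[]"] N by (simp add: C_def)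
    from reach_on_tapes[OF wfC lC _ this, of "[word_tape x]" 1 3 m "[]"]
    have 1: "reach D (7 * (length y + 1)) (start D, [word_tape x] @ [word_tape y, word_tape []] @ [])
        (exit_state D True, word_tape x # [word_tape y] @ [(cells (blocks N y), 0)])"
      by (simp add: D_def)
    have "0 \<notin> set (blocks N y)" using blocks_range[OF N, of y] by auto
    from verifier_reach[OF this, of I \<delta> m same ok x "[word_tape y]"]
    obtain ts where 2: "reach V (4 * length x + 6)
        (start V, word_tape x # [word_tape y] @ [(cells (blocks N y), 0)]) (exit_state V (A x y), ts)"
      unfolding V_def A_def by blast
    have "7 * (length y + 1) + (4 * length x + 6) + 1 \<le> poly p (length x)"
      using y by (simp add: p_def r_def algebra_simps)
    from reach_branch_continue[OF 1 2 this] show ?thesis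
      unfolding iM by (auto simp: M_def)
  qed

  have sound: "x \<in> GCSP I \<delta> \<H>" if A: "A x y" for x y
  proof -
    define tab where "tab = blocks N y"
    have tab: "tab \<noteq> []" "set tab \<subseteq> {1..N}" "verifies I \<delta> same ok tab (tab ! 0) 0 x"
      using A blocks_range[OF N, of y] unfolding A_def tab_def by auto
    obtain rest where rest: "x = unary (length tab) @ rest"
      "reads I \<delta> (lookup tab) (ok (tab ! 0)) (Idx 0) 0 rest" and sm: "\<forall>u\<in>set tab. same (tab ! 0) u"
      using tab(3) unfolding verifies_def by auto
    then obtain ts where ts: "rest = concat (map encode_tuple ts)" "well_typed I \<delta> ts"
      "\<And>i t. (i, t) \<in> set ts \<Longrightarrow> (\<forall>z\<in>set t. lookup tab z \<noteq> None) \<and>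
        ok (tab ! 0) (to_nat i) (map (\<lambda>z. the (lookup tab z)) t)"
      unfolding reads_iff[OF type] by fast
    define H where "H = fst (g (tab ! 0))"
    define h where "h z = snd (g (tab ! z))" for z
    have gS: "g (tab ! z) \<in> S" if "z < length tab" for z
    proof -
      have "tab ! z \<in> {1..N}" using tab(2) nth_mem[OF that] by blast
      then show ?thesis using g by (auto simp: bij_betw_def)
    qed
    have H: "H \<in> \<H>" using gS[of 0] tab(1) by (auto simp: H_def S_def)
    have hb: "h z \<in> base H" if "z < length tab" for z
      using gS[OF that] sm nth_mem[OF that] by (auto simp: H_def h_def S_def same_def)
    have tup: "set t \<subseteq> {..<length tab} \<and> map h t \<in> rel H i" if it: "(i, t) \<in> set ts" for i t
    proof -
      have lt: "z < length tab" if "z \<in> set t" for z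
        using ts(3)[OF it] that by (auto simp: lookup_def split: if_splits)
      have "map (\<lambda>u. snd (g u)) (map (\<lambda>z. the (lookup tab z)) t) = map h t"
        using lt by (simp add: h_def lookup_def)
      then show ?thesis using ts(3)[OF it] lt by (auto simp: ok_def H_def simp del: map_map)
    qed
    have "x = encode (length tab) ts" using rest(1) ts(1) by (simp add: encode_def)
    moreover have "below (length tab) ts" using tab(1) tup unfolding below_def by blast
    moreover have "maps_into (length tab) ts H h" using hb tup unfolding maps_into_def by blast
    ultimately show ?thesis using encode_in_GCSP_iff[OF ts(2)] H by blast
  qed

  have complete: "\<exists>y. length y \<le> poly r (length x) \<and> A x y" if x: "x \<in> GCSP I \<delta> \<H>" for x
  proof -
    obtain n ts H h where ts: "x = encode n ts" "well_typed I \<delta> ts" "below n ts"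
      and H: "H \<in> \<H>" "maps_into n ts H h"
      using x unfolding GCSP_iff by blast
    define q where "q z = inv_into {1..N} g (H, h z)" for z
    define tab where "tab = map q [0..<n]"
    define y where "y = concat (map (\<lambda>s. unary (s - 1)) tab)"
    have q: "q z \<in> {1..N}" "g (q z) = (H, h z)" if "z < n" for z
    proof -
      have "(H, h z) \<in> g ` {1..N}" using g H that by (auto simp: bij_betw_def S_def maps_into_def)
      then show "q z \<in> {1..N}" "g (q z) = (H, h z)"
        unfolding q_def by (rule inv_into_into, rule f_inv_into_f)
    qed
    have n: "0 < n" using ts(3) by (simp add: below_def)
    have tab: "set tab \<subseteq> {1..N}" "length tab = n" using q(1) by (auto simp: tab_def)
    have blk: "blocks N y = tab" unfolding y_def by (rule blocks_unary[OF tab(1)])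
    have "length (concat (map (\<lambda>s. unary (s - 1)) us)) \<le> N * length us" if "set us \<subseteq> {1..N}" for us
      using that by (induction us) (auto simp: unary_def)
    from this[OF tab(1)] have "length y \<le> N * n" unfolding y_def tab(2) .
    also have "N * n \<le> N * length x" by (rule mult_le_mono2) (simp add: ts(1) encode_def unary_def)
    finally have "length y \<le> poly r (length x)" by (simp add: r_def mult.commute)
    moreover have "A x y"
    proof -
      have t0: "fst (g (tab ! 0)) = H" using q(2)[OF n] n by (simp add: tab_def)
      have "same (tab ! 0) u" if u: "u \<in> set tab" for u
      proof -
        obtain z where "u = q z" "z < n" using u by (auto simp: tab_def)
        then show ?thesis using q(2)[of z] t0 by (simp add: same_def)
      qed
      moreover have "reads I \<delta> (lookup tab) (ok (tab ! 0)) (Idx 0) 0 (concat (map encode_tuple ts))"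
        unfolding reads_iff[OF type]
      proof (intro exI[of _ ts] conjI ballI refl ts(2))
        fix z assume "z \<in> set ts"
        then obtain i t where z: "z = (i, t)" "(i, t) \<in> set ts" by (metis surj_pair)
        have lt: "w < n" if "w \<in> set t" for w using ts(3) z(2) that by (auto simp: below_def)
        then have look: "lookup tab w = Some (q w)" if "w \<in> set t" for w
          using that by (simp add: lookup_def tab_def)
        have "map (\<lambda>u. snd (g u)) (map (\<lambda>z. the (lookup tab z)) t) = map h t"
          using look q(2) lt by simp
        moreover have "map h t \<in> rel H i" using H(2) z(2) by (auto simp: maps_into_def)
        ultimately have "ok (tab ! 0) (to_nat i) (map (\<lambda>z. the (lookup tab z)) t)"
          by (simp add: ok_def t0 del: map_map)
        then show "case z of (i, t) \<Rightarrow> (\<forall>x\<in>set t. lookup tab x \<noteq> None) \<and>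
            ok (tab ! 0) (to_nat i) (map (\<lambda>z. the (lookup tab z)) t)"
          using look z(1) by simp
      qed
      moreover have "0 \<notin> set tab" using tab(1) by auto
      ultimately have "verifies I \<delta> same ok tab (tab ! 0) 0 x"
        using tab(2) ts(1) by (simp add: verifies_def encode_def)
      then show ?thesis using tab(2) n unfolding A_def blk by auto
    qed
    ultimately show ?thesis by blast
  qed

  show ?thesis
    by (rule class_NP_I[OF wfM, of r p A]) (use tapesM run sound complete in auto)
qed

section \<open>The complexity of generalised constraint satisfaction problems\<close>

theorem mainTheorem7:
  fixes I :: "'i::countable set" and \<delta> :: "'i \<Rightarrow> nat"
    and \<H> :: "('a, 'i) rstruct set"
  assumes "is_type I \<delta>"
    and "finite \<H>" and "\<H> \<noteq> {}"
    and "\<forall>H\<in>\<H>. is_structure I \<delta> H"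
    and "pairwise (incomparable I) \<H>"
  shows "((\<forall>H\<in>\<H>. tractable (CSP I \<delta> H)) \<longrightarrow> tractable (GCSP I \<delta> \<H>)) \<and>
         ((\<exists>H\<in>\<H>. NP_complete (CSP I \<delta> H)) \<longrightarrow> NP_complete (GCSP I \<delta> \<H>))"
proof (intro conjI impI)
  assume "\<forall>H\<in>\<H>. tractable (CSP I \<delta> H)"
  with assms(2,3) show "tractable (GCSP I \<delta> \<H>)"
  proof (induction \<H> rule: finite_ne_induct)
    case (singleton H)
    then show ?case by (simp add: CSP_eq_GCSP)
  next
    case (insert H \<H>)
    then show ?case by (simp add: GCSP_insert class_P_Un)
  qed
next
  assume "\<exists>H\<in>\<H>. NP_complete (CSP I \<delta> H)"
  then obtain H where "H \<in> \<H>" "\<forall>L\<in>class_NP. poly_reducible L (CSP I \<delta> H)"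
    unfolding NP_complete_def by blast
  then have "\<forall>L\<in>class_NP. poly_reducible L (GCSP I \<delta> \<H>)"
    using CSP_reduces_to_GCSP assms(1,4,5) by blast
  then show "NP_complete (GCSP I \<delta> \<H>)"
    unfolding NP_complete_def using GCSP_in_NP assms(1-4) by blast
qed

end
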